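(* Let $\mathbb{K}$ be a field, let $G$ be a finite simple graph and let $I(G)$ be its edge ideal. For any $i\geq 0$ and any $j\geq i+2$, if $\beta_{i,j}(I(G))=\beta_{i,j+1}(I(G))=0$ then $\beta_{i+1,j+2}(I(G))=0$.
   Context: For a finite simple graph $G$, $R$ is the polynomial ring over $\mathbb{K}$ whose variables are the vertices of $G$, with the standard grading, and the edge ideal $I(G)\subset R$ is generated by the monomials $uv$ with $\{u,v\}\in E(G)$. For a homogeneous ideal $I\subset R$, the graded Betti number $\beta_{i,j}(I)$ is the number of copies of $R(-j)$ in homological degree $i$ in the minimal graded free resolution of $I$ (of the ideal $I$, not of $R/I$; so $\beta_{0,j}(I)$ counts minimal generators of $I$ of degree $j$). *)

theory Defs
  imports Complex_Main "HOL-Library.Poly_Mapping"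
begin

section \<open>Finite simple graphs\<close>

definition finite_simple_graph :: "'v set \<Rightarrow> 'v set set \<Rightarrow> bool" where
  "finite_simple_graph V E \<longleftrightarrow> finite V \<and> (\<forall>e\<in>E. e \<subseteq> V \<and> card e = 2)"


section \<open>The polynomial ring on the vertices\<close>

text \<open>
  Monomials are exponent vectors \<^typ>\<open>'v \<Rightarrow>\<^sub>0 nat\<close>; the convolution product of
  \<^theory>\<open>HOL-Library.Poly_Mapping\<close> is then polynomial multiplication.
\<close>

type_synonym ('v, 'k) mpoly = "('v \<Rightarrow>\<^sub>0 nat) \<Rightarrow>\<^sub>0 'k"

definition poly_ring :: "'v set \<Rightarrow> ('v, 'k::zero) mpoly set" where
  "poly_ring V = {p. \<forall>m\<in>Poly_Mapping.keys p. Poly_Mapping.keys m \<subseteq> V}"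

definition var :: "'v \<Rightarrow> ('v, 'k::zero_neq_one) mpoly" where
  "var v = Poly_Mapping.single (Poly_Mapping.single v 1) 1"

definition mdeg :: "('v \<Rightarrow>\<^sub>0 nat) \<Rightarrow> nat" where
  "mdeg m = (\<Sum>v\<in>Poly_Mapping.keys m. Poly_Mapping.lookup m v)"

definition homogeneous :: "nat \<Rightarrow> ('v, 'k::zero) mpoly \<Rightarrow> bool" where
  "homogeneous n p \<longleftrightarrow> (\<forall>m\<in>Poly_Mapping.keys p. mdeg m = n)"

definition generated_ideal :: "'v set \<Rightarrow> ('v, 'k::comm_ring_1) mpoly set \<Rightarrow> ('v, 'k) mpoly set" where
  "generated_ideal V S =
     {(\<Sum>s\<in>T. c s * s) | c T. finite T \<and> T \<subseteq> S \<and> (\<forall>s\<in>T. c s \<in> poly_ring V)}"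

definition edge_ideal :: "'v set \<Rightarrow> 'v set set \<Rightarrow> ('v, 'k::field) mpoly set" where
  "edge_ideal V E = generated_ideal V {var u * var v | u v. {u, v} \<in> E}"


section \<open>Graded free modules\<close>

text \<open>
  For \<open>b :: nat \<Rightarrow> nat\<close>, \<open>graded_free V b\<close> is the direct sum over \<open>j\<close> of \<open>b j\<close> copies of
  \<open>R(-j)\<close>, where \<open>R = poly_ring V\<close>. The basis element \<open>(j, k)\<close> with \<open>k < b j\<close> generates the
  \<open>k\<close>-th copy of \<open>R(-j)\<close>, so it has degree \<open>j\<close>.
\<close>

type_synonym ('v, 'k) free_elem = "(nat \<times> nat) \<Rightarrow>\<^sub>0 ('v, 'k) mpoly"

definition graded_free :: "'v set \<Rightarrow> (nat \<Rightarrow> nat) \<Rightarrow> ('v, 'k::zero) free_elem set" where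
  "graded_free V b =
     {x. Poly_Mapping.keys x \<subseteq> {(j, k). k < b j}
        \<and> (\<forall>e\<in>Poly_Mapping.keys x. Poly_Mapping.lookup x e \<in> poly_ring V)}"

definition scale :: "('v, 'k::comm_ring_1) mpoly \<Rightarrow> ('v, 'k) free_elem \<Rightarrow> ('v, 'k) free_elem" where
  "scale r x = Poly_Mapping.map (\<lambda>p. r * p) x"

definition free_homogeneous :: "nat \<Rightarrow> ('v, 'k::zero) free_elem \<Rightarrow> bool" where
  "free_homogeneous n x \<longleftrightarrow>
     (\<forall>(j, k)\<in>Poly_Mapping.keys x.
        \<forall>m\<in>Poly_Mapping.keys (Poly_Mapping.lookup x (j, k)). mdeg m + j = n)"

definition linear_over ::
  "'r set \<Rightarrow> 'a set \<Rightarrow> ('r \<Rightarrow> 'a::plus \<Rightarrow> 'a) \<Rightarrow> ('r \<Rightarrow> 'b::plus \<Rightarrow> 'b) \<Rightarrow> ('a \<Rightarrow> 'b) \<Rightarrow> bool" where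
  "linear_over R M s t f \<longleftrightarrow>
     (\<forall>x\<in>M. \<forall>y\<in>M. f (x + y) = f x + f y) \<and> (\<forall>r\<in>R. \<forall>x\<in>M. f (s r x) = t r (f x))"


section \<open>Minimal graded free resolutions and graded Betti numbers\<close>

text \<open>
  The data of a complex \<open>\<dots> \<rightarrow> F\<^sub>2 \<rightarrow> F\<^sub>1 \<rightarrow> F\<^sub>0 \<rightarrow> R\<close>, where \<open>F\<^sub>i = graded_free V (copies F i)\<close>:
  \<open>copies F i j\<close> is the number of copies of \<open>R(-j)\<close> in \<open>F\<^sub>i\<close>, \<open>differential F i\<close> maps
  \<open>F\<^sub>i\<^sub>+\<^sub>1\<close> to \<open>F\<^sub>i\<close>, and \<open>augmentation F\<close> maps \<open>F\<^sub>0\<close> to \<open>R\<close>. The values of these maps outside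
  the modules are irrelevant.
\<close>

record (overloaded) ('v, 'k) graded_complex =
  copies :: "nat \<Rightarrow> nat \<Rightarrow> nat"
  differential :: "nat \<Rightarrow> ('v, 'k::zero) free_elem \<Rightarrow> ('v, 'k) free_elem"
  augmentation :: "('v, 'k::zero) free_elem \<Rightarrow> ('v, 'k) mpoly"

text \<open>
  The resolution is one of the ideal \<open>I\<close>, not of \<open>R/I\<close>: the augmentation maps \<open>F\<^sub>0\<close> onto \<open>I\<close>.
  The definition asks for finitely many copies of each \<open>R(-j)\<close> in each \<open>F\<^sub>i\<close>, not for finite
  total rank; for finite \<open>V\<close> the latter is automatic for minimal resolutions, because \<open>R\<close> is
  Noetherian and minimal graded free resolutions are unique up to isomorphism. Minimality says that
  the differentials map \<open>F\<^sub>i\<^sub>+\<^sub>1\<close> into \<open>\<mm> F\<^sub>i\<close>, where \<open>\<mm>\<close> is the ideal of polynomials without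
  constant term.
\<close>

locale minimal_graded_free_resolution =
  fixes V :: "'v set"
    and I :: "('v, 'k::field) mpoly set"
    and F :: "('v, 'k) graded_complex"
  assumes differential_into:
      "differential F i ` graded_free V (copies F (Suc i)) \<subseteq> graded_free V (copies F i)"
    and differential_linear:
      "linear_over (poly_ring V) (graded_free V (copies F (Suc i))) scale scale (differential F i)"
    and differential_graded:
      "x \<in> graded_free V (copies F (Suc i)) \<Longrightarrow> free_homogeneous n x
         \<Longrightarrow> free_homogeneous n (differential F i x)"
    and augmentation_linear:
      "linear_over (poly_ring V) (graded_free V (copies F 0)) scale (*) (augmentation F)"
    and augmentation_graded:
      "x \<in> graded_free V (copies F 0) \<Longrightarrow> free_homogeneous n x
         \<Longrightarrow> homogeneous n (augmentation F x)"
    and augmentation_onto: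
      "augmentation F ` graded_free V (copies F 0) = I"
    and exact_0:
      "{x \<in> graded_free V (copies F 0). augmentation F x = 0}
         = differential F 0 ` graded_free V (copies F (Suc 0))"
    and exact_Suc:
      "{x \<in> graded_free V (copies F (Suc i)). differential F i x = 0}
         = differential F (Suc i) ` graded_free V (copies F (Suc (Suc i)))"
    and minimal:
      "x \<in> graded_free V (copies F (Suc i))
         \<Longrightarrow> Poly_Mapping.lookup (Poly_Mapping.lookup (differential F i x) e) 0 = 0"

text \<open>
  By uniqueness of minimal graded free resolutions up to isomorphism, the value does not depend on
  the chosen resolution.
\<close>

definition graded_betti :: "'v set \<Rightarrow> ('v, 'k::field) mpoly set \<Rightarrow> nat \<Rightarrow> nat \<Rightarrow> nat" where
  "graded_betti V I i j = copies (SOME F. minimal_graded_free_resolution V I F) i j"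

end

theory Submission
  imports Defs
begin

text \<open>
  The Betti numbers of an ideal \<open>I\<close> are the dimensions of the graded pieces of the Koszul homology
  \<open>H(x; I)\<close>, and for a monomial ideal this homology splits into multidegrees. In multidegree \<open>m\<close> it is
  the reduced homology of the upper Koszul complex, whose faces are the vertex sets \<open>S\<close> such that
  \<open>m\<close> divided by the product of \<open>S\<close> is a monomial of \<open>I\<close>. For an edge ideal this complex is a
  cone unless \<open>m\<close> is squarefree, and for the product \<open>m\<close> of a vertex set \<open>W\<close> it consists of the
  subsets \<open>S\<close> of \<open>W\<close> for which \<open>W - S\<close> contains an edge; call it \<open>N(W)\<close>. Therefore the Betti
  number in homological degree \<open>i\<close> and degree \<open>n\<close> is zero iff for every \<open>W\<close> with \<open>n\<close> elements
  each cycle of \<open>N(W)\<close> on sets of size \<open>i\<close> is a boundary (\<open>koszul_vanishes_iff_no_generators\<close>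
  and \<open>koszul_vanishes_edge_ideal_iff\<close>).

  The theorem becomes a statement about these complexes (\<open>acyclic_at_noncovers\<close>). The link of a
  vertex \<open>v\<close> in \<open>N(W)\<close> is \<open>N(W - v)\<close>. Let \<open>W\<close> have \<open>j + 2\<close> elements. If it contains no edge,
  \<open>N(W)\<close> is empty. Otherwise let \<open>vw\<close> be an edge inside \<open>W\<close>, and let \<open>c\<close> be a cycle on
  sets of size \<open>i + 1\<close>. Its part at \<open>v\<close> is a cycle on sets of size \<open>i\<close> in \<open>N(W - v)\<close>, hence a boundary there, which allows \<open>c\<close> to be replaced by a homologous
  cycle that avoids \<open>v\<close>. The same step for \<open>w\<close> produces a cycle that avoids both, where acyclicity of
  \<open>N(W - v - w)\<close> is what keeps \<open>v\<close> away. This cycle lives on subsets of \<open>W - v - w\<close>, and all of them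
  are faces because their complement contains \<open>vw\<close>. As \<open>j > 0\<close>, this simplex has a vertex and is a
  cone, so the cycle is a boundary. The three complexes \<open>N(W - v)\<close>, \<open>N(W - w)\<close>, \<open>N(W - v - w)\<close>
  are the ones that the two hypotheses control.

  Two pieces of homological algebra link this to resolutions. First, \<open>graded_betti\<close> reads its
  value off some chosen minimal resolution, so such a resolution has to exist: it is built by choosing
  minimal generators degree by degree and iterating on kernels (\<open>minimal_free_cover\<close>,
  \<open>minimally_resolves_exists\<close>). Second, for an arbitrary minimal resolution, the vanishing of
  Koszul homology is carried along the resolution one syzygy module at a time
  (\<open>koszul_vanishes_shift\<close>), because the Koszul complex of a free module is exact in positive
  homological degrees; in homological degree \<open>0\<close> it becomes the absence of generators.
\<close>

section \<open>Coefficients and degrees in free modules\<close>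

definition fcoeff :: "('v, 'k::zero) free_elem \<Rightarrow> nat \<times> nat \<Rightarrow> ('v \<Rightarrow>\<^sub>0 nat) \<Rightarrow> 'k" where
  "fcoeff x e m = Poly_Mapping.lookup (Poly_Mapping.lookup x e) m"

text \<open>
  Everything about polynomials and free modules is expressed by the scalar coefficients at pairs
  of a basis element and a monomial.
\<close>

lemma free_elem_eqI: "(\<And>e m. fcoeff x e m = fcoeff y e m) \<Longrightarrow> x = y"
  by (auto simp: fcoeff_def intro!: poly_mapping_eqI)

lemma fcoeff_zero [simp]: "fcoeff 0 e m = 0"
  by (simp add: fcoeff_def)

lemma fcoeff_add: "fcoeff (x + y) e m = fcoeff x e m + fcoeff y e m"
  by (simp add: fcoeff_def lookup_add)

lemma fcoeff_uminus: "fcoeff (- x) e m = - fcoeff x e m"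
  for x :: "('v, 'k::ab_group_add) free_elem"
  by (simp add: fcoeff_def)

lemma fcoeff_diff: "fcoeff (x - y) e m = fcoeff x e m - fcoeff y e m"
  for x y :: "('v, 'k::ab_group_add) free_elem"
  by (simp add: fcoeff_def lookup_minus)

lemma fcoeff_sum: "fcoeff (sum f A) e m = (\<Sum>a\<in>A. fcoeff (f a) e m)"
  by (simp add: fcoeff_def lookup_sum)

lemma fcoeff_single:
  "fcoeff (Poly_Mapping.single e (Poly_Mapping.single m a)) e' m' = (if e' = e \<and> m' = m then a else 0)"
  by (auto simp: fcoeff_def lookup_single when_def)

lemma finite_support_fcoeff: "finite {(e, m). fcoeff x e m \<noteq> 0}"
proof -
  have "{(e, m). fcoeff x e m \<noteq> 0} \<subseteq>
      Sigma (Poly_Mapping.keys x) (\<lambda>e. Poly_Mapping.keys (Poly_Mapping.lookup x e))"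
    by (auto simp: fcoeff_def in_keys_iff)
  then show ?thesis
    by (rule finite_subset) auto
qed

lemma lookup_scale: "Poly_Mapping.lookup (scale r x) e = r * Poly_Mapping.lookup x e"
  by (auto simp: scale_def map.rep_eq when_def)

lemma scale_add_right: "scale r (x + y) = scale r x + scale r y"
  and scale_add_left: "scale (r + s) x = scale r x + scale s x"
  and scale_scale: "scale r (scale s x) = scale (r * s) x"
  and scale_one [simp]: "scale 1 x = x"
  and scale_zero_right [simp]: "scale r 0 = 0"
  and scale_zero_left [simp]: "scale 0 x = 0"
  and scale_uminus_left: "scale (- r) x = - scale r x"
  by (auto intro!: poly_mapping_eqI simp: lookup_scale lookup_add algebra_simps)

lemma scale_sum_right: "scale r (sum f A) = (\<Sum>a\<in>A. scale r (f a))"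
  by (induction A rule: infinite_finite_induct) (auto simp: scale_add_right)

lemma scale_sum_left: "scale (sum f A) x = (\<Sum>a\<in>A. scale (f a) x)"
  by (induction A rule: infinite_finite_induct) (auto simp: scale_add_left)

lemma lookup_var_mult:
  fixes p :: "('v, 'k::comm_ring_1) mpoly"
  shows "Poly_Mapping.lookup (var v * p) m =
    (if v \<in> Poly_Mapping.keys m then Poly_Mapping.lookup p (m - Poly_Mapping.single v 1) else 0)"
proof -
  have *: "(m = Poly_Mapping.single v 1 + q) \<longleftrightarrow>
      v \<in> Poly_Mapping.keys m \<and> q = m - Poly_Mapping.single v 1" for q
  proof
    assume "v \<in> Poly_Mapping.keys m \<and> q = m - Poly_Mapping.single v 1"
    then show "m = Poly_Mapping.single v 1 + q"
      by (auto intro!: poly_mapping_eqI simp: lookup_add lookup_minus lookup_single when_def in_keys_iff)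
  qed (auto simp: in_keys_iff lookup_add)
  have "Poly_Mapping.lookup (var v * p) m =
     Poly_Mapping.lookup (var v) (Poly_Mapping.single v 1) *
       (\<Sum>q. Poly_Mapping.lookup p q when m = Poly_Mapping.single v 1 + q)"
    unfolding lookup_mult
    by (subst Sum_any.expand_superset[where A = "{Poly_Mapping.single v 1}"])
      (auto simp: var_def lookup_single when_def split: if_splits)
  also have "\<dots> = (if v \<in> Poly_Mapping.keys m then Poly_Mapping.lookup p (m - Poly_Mapping.single v 1) else 0)"
    unfolding *
    by (cases "v \<in> Poly_Mapping.keys m") (auto simp: var_def)
  finally show ?thesis .
qed

lemma fcoeff_scale_var:
  "fcoeff (scale (var v) x) e m =
    (if v \<in> Poly_Mapping.keys m then fcoeff x e (m - Poly_Mapping.single v 1) else 0)"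
  by (simp add: fcoeff_def lookup_scale lookup_var_mult)

lemma mdeg_superset: "finite A \<Longrightarrow> Poly_Mapping.keys m \<subseteq> A \<Longrightarrow> mdeg m = (\<Sum>v\<in>A. Poly_Mapping.lookup m v)"
  unfolding mdeg_def by (rule sum.mono_neutral_left) (auto simp: in_keys_iff)

lemma mdeg_add: "mdeg (a + b) = mdeg a + mdeg b"
proof -
  let ?A = "Poly_Mapping.keys a \<union> Poly_Mapping.keys b"
  have "mdeg (a + b) = (\<Sum>v\<in>?A. Poly_Mapping.lookup (a + b) v)"
    by (rule mdeg_superset) (auto dest: set_mp[OF keys_add])
  also have "\<dots> = (\<Sum>v\<in>?A. Poly_Mapping.lookup a v) + (\<Sum>v\<in>?A. Poly_Mapping.lookup b v)"
    by (simp add: lookup_add sum.distrib)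
  finally show ?thesis
    using mdeg_superset[of ?A a] mdeg_superset[of ?A b] by simp
qed

lemma mdeg_zero [simp]: "mdeg 0 = 0"
  by (simp add: mdeg_def)

lemma mdeg_single [simp]: "mdeg (Poly_Mapping.single v n) = n"
  by (simp add: mdeg_def)

lemma mdeg_eq_0_iff: "mdeg m = 0 \<longleftrightarrow> m = 0"
  by (auto simp: mdeg_def in_keys_iff intro: poly_mapping_eqI)

lemma keys_add_nat: "Poly_Mapping.keys (a + b) = Poly_Mapping.keys a \<union> Poly_Mapping.keys b"
  for a b :: "'v \<Rightarrow>\<^sub>0 nat"
  by (auto simp: in_keys_iff lookup_add)

lemma finite_monomials: 
  assumes "finite V" shows "finite {m. Poly_Mapping.keys m \<subseteq> V \<and> mdeg m \<le> n}"
proof -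
  let ?M = "{m. Poly_Mapping.keys m \<subseteq> V \<and> mdeg m \<le> n}"
  have "Poly_Mapping.lookup ` ?M \<subseteq> {f. (\<forall>v. v \<in> V \<longrightarrow> f v \<in> {..n}) \<and> (\<forall>v. v \<notin> V \<longrightarrow> f v = 0)}"
  proof clarsimp
    fix m assume m: "Poly_Mapping.keys m \<subseteq> V" "mdeg m \<le> n"
    have "Poly_Mapping.lookup m v \<le> n" for v
    proof (cases "v \<in> Poly_Mapping.keys m")
      case True
      then have "Poly_Mapping.lookup m v \<le> mdeg m"
        unfolding mdeg_def by (intro member_le_sum) auto
      then show ?thesis using m by simp
    qed (simp add: in_keys_iff)
    then show "(\<forall>v. v \<in> V \<longrightarrow> Poly_Mapping.lookup m v \<le> n) \<and> (\<forall>v. v \<notin> V \<longrightarrow> Poly_Mapping.lookup m v = 0)"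
      using m by (auto simp: in_keys_iff)
  qed
  moreover have "finite {f. (\<forall>v. v \<in> V \<longrightarrow> f v \<in> {..n}) \<and> (\<forall>v. v \<notin> V \<longrightarrow> f v = 0)}"
    using finite_set_of_finite_funs[OF assms, of "{..n}" 0] by (simp add: all_conj_distrib)
  ultimately have "finite (Poly_Mapping.lookup ` ?M)"
    by (rule finite_subset)
  then show ?thesis
    by (rule finite_imageD) (auto simp: inj_on_def intro: poly_mapping_eqI)
qed

lemma in_keys_fcoeffI: "fcoeff x e m \<noteq> 0 \<Longrightarrow> e \<in> Poly_Mapping.keys x"
  by (auto simp: fcoeff_def in_keys_iff)

lemma in_keys_lookup_iff: "m \<in> Poly_Mapping.keys (Poly_Mapping.lookup x e) \<longleftrightarrow> fcoeff x e m \<noteq> 0"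
  by (auto simp: fcoeff_def in_keys_iff)

lemma in_keys_fcoeffE:
  assumes "e \<in> Poly_Mapping.keys x"
  obtains m where "fcoeff x e m \<noteq> 0"
  using assms by (metis fcoeff_def in_keys_iff lookup_zero poly_mapping_eqI)

lemma free_homogeneous_iff:
  "free_homogeneous n x \<longleftrightarrow> (\<forall>e m. fcoeff x e m \<noteq> 0 \<longrightarrow> mdeg m + fst e = n)"
  unfolding free_homogeneous_def in_keys_lookup_iff
  by (auto simp: in_keys_lookup_iff split: prod.splits dest!: bspec[OF _ in_keys_fcoeffI])

lemma free_homogeneousD: "free_homogeneous n x \<Longrightarrow> fcoeff x e m \<noteq> 0 \<Longrightarrow> mdeg m + fst e = n"
  unfolding free_homogeneous_iff by blast

lemma free_homogeneousI: "(\<And>e m. fcoeff x e m \<noteq> 0 \<Longrightarrow> mdeg m + fst e = n) \<Longrightarrow> free_homogeneous n x"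
  unfolding free_homogeneous_iff by blast

lemma graded_free_iff:
  "x \<in> graded_free V b \<longleftrightarrow>
    (\<forall>e m. fcoeff x e m \<noteq> 0 \<longrightarrow> snd e < b (fst e) \<and> Poly_Mapping.keys m \<subseteq> V)"
proof
  assume x: "x \<in> graded_free V b"
  show "\<forall>e m. fcoeff x e m \<noteq> 0 \<longrightarrow> snd e < b (fst e) \<and> Poly_Mapping.keys m \<subseteq> V"
  proof (intro allI impI)
    fix e m assume m: "fcoeff x e m \<noteq> 0"
    from m have e: "e \<in> Poly_Mapping.keys x"
      by (rule in_keys_fcoeffI)
    with x have "e \<in> {(j, k). k < b j}" "Poly_Mapping.lookup x e \<in> poly_ring V"
      unfolding graded_free_def by blast+
    with m show "snd e < b (fst e) \<and> Poly_Mapping.keys m \<subseteq> V"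
      by (auto simp: poly_ring_def in_keys_lookup_iff split: prod.splits)
  qed
next
  assume r: "\<forall>e m. fcoeff x e m \<noteq> 0 \<longrightarrow> snd e < b (fst e) \<and> Poly_Mapping.keys m \<subseteq> V"
  then have "e \<in> Poly_Mapping.keys x \<Longrightarrow> snd e < b (fst e)" for e
    using in_keys_fcoeffE by metis
  then have "Poly_Mapping.keys x \<subseteq> {(j, k). k < b j}"
    by fastforce
  moreover have "Poly_Mapping.lookup x e \<in> poly_ring V" for e
    unfolding poly_ring_def by (auto simp: in_keys_lookup_iff dest!: r[rule_format])
  ultimately show "x \<in> graded_free V b"
    unfolding graded_free_def by blast
qed

definition hom_component :: "nat \<Rightarrow> ('v, 'k::zero) free_elem \<Rightarrow> ('v, 'k) free_elem" where
  "hom_component n x = Poly_Mapping.mapp (\<lambda>e. Poly_Mapping.mapp (\<lambda>m a. if mdeg m + fst e = n then a else 0)) x"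

lemma fcoeff_hom_component: "fcoeff (hom_component n x) e m = (if mdeg m + fst e = n then fcoeff x e m else 0)"
  by (auto simp: hom_component_def fcoeff_def lookup_mapp when_def in_keys_iff)

lemma free_homogeneous_hom_component [simp]: "free_homogeneous n (hom_component n x)"
  by (auto simp: free_homogeneous_iff fcoeff_hom_component)

lemma hom_component_id: "free_homogeneous n x \<Longrightarrow> hom_component n x = x"
  by (rule free_elem_eqI) (auto simp: fcoeff_hom_component dest: free_homogeneousD)

lemma hom_component_eq_0: "free_homogeneous n x \<Longrightarrow> n \<noteq> k \<Longrightarrow> hom_component k x = 0"
  by (rule free_elem_eqI) (auto simp: fcoeff_hom_component dest: free_homogeneousD)

lemma hom_component_add: "hom_component n (x + y) = hom_component n x + hom_component n y"
  by (rule free_elem_eqI) (auto simp: fcoeff_hom_component fcoeff_add)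

lemma hom_component_zero [simp]: "hom_component n 0 = 0"
  by (rule free_elem_eqI) (auto simp: fcoeff_hom_component)

lemma hom_component_sum: "hom_component n (sum f A) = (\<Sum>a\<in>A. hom_component n (f a))"
  by (induction A rule: infinite_finite_induct) (auto simp: hom_component_add)

lemma sum_hom_component:
  obtains N where "finite N" "x = (\<Sum>n\<in>N. hom_component n x)"
proof
  let ?N = "(\<lambda>(e, m). mdeg m + fst e) ` {(e, m). fcoeff x e m \<noteq> 0}"
  show "finite ?N"
    using finite_support_fcoeff by (rule finite_imageI)
  then show "x = (\<Sum>n\<in>?N. hom_component n x)"
    by (intro free_elem_eqI) (force simp: fcoeff_sum fcoeff_hom_component)
qed

lemma free_homogeneous_zero [simp]: "free_homogeneous n 0"
  by (simp add: free_homogeneous_iff)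

lemma free_homogeneous_add:
  "free_homogeneous n x \<Longrightarrow> free_homogeneous n y \<Longrightarrow> free_homogeneous n (x + y)"
  by (rule free_homogeneousI) (metis add_0 fcoeff_add free_homogeneousD)

lemma free_homogeneous_sum:
  "(\<And>a. a \<in> A \<Longrightarrow> free_homogeneous n (f a)) \<Longrightarrow> free_homogeneous n (sum f A)"
  by (induction A rule: infinite_finite_induct) (auto intro: free_homogeneous_add)

lemma free_homogeneous_scale:
  fixes x :: "('v, 'k::comm_ring_1) free_elem"
  assumes "homogeneous a p" "free_homogeneous b x"
  shows "free_homogeneous (a + b) (scale p x)"
  unfolding free_homogeneous_iff
proof (intro allI impI)
  fix e m assume "fcoeff (scale p x) e m \<noteq> 0"
  then have "m \<in> Poly_Mapping.keys (p * Poly_Mapping.lookup x e)"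
    by (simp add: fcoeff_def lookup_scale in_keys_iff)
  then obtain c d where cd: "m = c + d" "c \<in> Poly_Mapping.keys p" "d \<in> Poly_Mapping.keys (Poly_Mapping.lookup x e)"
    using keys_mult[of p "Poly_Mapping.lookup x e"] by auto
  then have "fcoeff x e d \<noteq> 0"
    by (simp add: fcoeff_def in_keys_iff)
  then show "mdeg m + fst e = a + b"
    using assms(1) free_homogeneousD[OF assms(2)] cd by (auto simp: homogeneous_def mdeg_add)
qed

lemma homogeneous_var: "homogeneous 1 (var v)"
  by (auto simp: homogeneous_def var_def)

lemma poly_ring_single: "Poly_Mapping.keys m \<subseteq> V \<Longrightarrow> Poly_Mapping.single m a \<in> poly_ring V"
  by (auto simp: poly_ring_def)

lemma poly_ring_var: "v \<in> V \<Longrightarrow> var v \<in> poly_ring V"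
  by (auto simp: var_def poly_ring_def)

lemma poly_ring_one: "1 \<in> poly_ring V"
  and poly_ring_zero: "0 \<in> poly_ring V"
  by (auto simp: poly_ring_def)

lemma poly_ring_uminus: "p \<in> poly_ring V \<Longrightarrow> - p \<in> poly_ring V"
  for p :: "('v, 'k::ab_group_add) mpoly"
  by (auto simp: poly_ring_def)

lemma poly_ring_add: "p \<in> poly_ring V \<Longrightarrow> q \<in> poly_ring V \<Longrightarrow> p + q \<in> poly_ring V"
  using keys_add[of p q] by (force simp: poly_ring_def)

lemma sum_monomials: "p = (\<Sum>m\<in>Poly_Mapping.keys p. Poly_Mapping.single m (Poly_Mapping.lookup p m))"
  by (rule poly_mapping_eqI) (auto simp: lookup_sum lookup_single when_def in_keys_iff)

section \<open>Graded submodules and graded maps\<close>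

definition graded_submodule :: "'v set \<Rightarrow> ('v, 'k::comm_ring_1) free_elem set \<Rightarrow> bool" where
  "graded_submodule V M \<longleftrightarrow> 0 \<in> M \<and> (\<forall>x\<in>M. \<forall>y\<in>M. x + y \<in> M) \<and>
    (\<forall>p\<in>poly_ring V. \<forall>x\<in>M. scale p x \<in> M) \<and> (\<forall>n. \<forall>x\<in>M. hom_component n x \<in> M)"

definition graded_map ::
  "'v set \<Rightarrow> ('v, 'k::comm_ring_1) free_elem set \<Rightarrow> (('v, 'k) free_elem \<Rightarrow> ('v, 'k) free_elem) \<Rightarrow> bool" where
  "graded_map V M f \<longleftrightarrow> linear_over (poly_ring V) M scale scale f \<and>
    (\<forall>n. \<forall>x\<in>M. free_homogeneous n x \<longrightarrow> free_homogeneous n (f x))"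

lemma graded_submodule_zero: "graded_submodule V M \<Longrightarrow> 0 \<in> M"
  and graded_submodule_add: "graded_submodule V M \<Longrightarrow> x \<in> M \<Longrightarrow> y \<in> M \<Longrightarrow> x + y \<in> M"
  and graded_submodule_scale: "graded_submodule V M \<Longrightarrow> p \<in> poly_ring V \<Longrightarrow> x \<in> M \<Longrightarrow> scale p x \<in> M"
  and graded_submodule_hom_component: "graded_submodule V M \<Longrightarrow> x \<in> M \<Longrightarrow> hom_component n x \<in> M"
  by (simp_all add: graded_submodule_def)

lemma graded_submodule_uminus: "graded_submodule V M \<Longrightarrow> x \<in> M \<Longrightarrow> - x \<in> M"
  using graded_submodule_scale[OF _ poly_ring_uminus[OF poly_ring_one], of V M x]
  by (simp add: scale_uminus_left)

lemma graded_submodule_diff: "graded_submodule V M \<Longrightarrow> x \<in> M \<Longrightarrow> y \<in> M \<Longrightarrow> x - y \<in> M"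
  using graded_submodule_add[of V M x "- y"] graded_submodule_uminus[of V M y] by simp

lemma graded_submodule_sum:
  "graded_submodule V M \<Longrightarrow> (\<And>a. a \<in> A \<Longrightarrow> f a \<in> M) \<Longrightarrow> sum f A \<in> M"
  by (induction A rule: infinite_finite_induct)
    (auto intro: graded_submodule_zero graded_submodule_add)

lemma graded_map_add: "graded_map V M f \<Longrightarrow> x \<in> M \<Longrightarrow> y \<in> M \<Longrightarrow> f (x + y) = f x + f y"
  and graded_map_scale: "graded_map V M f \<Longrightarrow> p \<in> poly_ring V \<Longrightarrow> x \<in> M \<Longrightarrow> f (scale p x) = scale p (f x)"
  and graded_map_homogeneous:
    "graded_map V M f \<Longrightarrow> x \<in> M \<Longrightarrow> free_homogeneous n x \<Longrightarrow> free_homogeneous n (f x)"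
  by (simp_all add: graded_map_def linear_over_def)

context
  fixes V M and f :: "('v, 'k::comm_ring_1) free_elem \<Rightarrow> ('v, 'k) free_elem"
  assumes M: "graded_submodule V M" and f: "graded_map V M f"
begin

lemma graded_map_zero: "f 0 = 0"
  using graded_map_add[OF f, of 0 0] graded_submodule_zero[OF M] by simp

lemma graded_map_uminus: "x \<in> M \<Longrightarrow> f (- x) = - f x"
  using graded_map_scale[OF f poly_ring_uminus[OF poly_ring_one], of x]
  by (simp add: scale_uminus_left)

lemma graded_map_diff: "x \<in> M \<Longrightarrow> y \<in> M \<Longrightarrow> f (x - y) = f x - f y"
  using graded_map_add[OF f, of x "- y"] graded_submodule_uminus[OF M] graded_map_uminus by simp

lemma graded_map_sum: "(\<And>a. a \<in> A \<Longrightarrow> g a \<in> M) \<Longrightarrow> f (sum g A) = (\<Sum>a\<in>A. f (g a))"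
  by (induction A rule: infinite_finite_induct)
    (auto simp: graded_map_zero graded_map_add[OF f] graded_submodule_sum[OF M])

text \<open>
  An element is the sum of its homogeneous components, and a graded map keeps each component in its
  degree, so the components of the image are the images of the components.
\<close>

lemma graded_map_hom_component: "x \<in> M \<Longrightarrow> f (hom_component n x) = hom_component n (f x)"
proof -
  assume x: "x \<in> M"
  obtain N where N: "finite N" "x = (\<Sum>k\<in>N. hom_component k x)"
    by (rule sum_hom_component)
  have "f x = (\<Sum>k\<in>N. f (hom_component k x))"
    using x by (subst N(2)) (auto intro: graded_map_sum graded_submodule_hom_component[OF M])
  then have "hom_component n (f x) = (\<Sum>k\<in>N. hom_component n (f (hom_component k x)))"
    by (simp add: hom_component_sum)
  also have "\<dots> = (\<Sum>k\<in>N. if k = n then f (hom_component n x) else 0)"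
  proof (rule sum.cong[OF refl])
    fix k
    have "free_homogeneous k (f (hom_component k x))"
      using graded_map_homogeneous[OF f graded_submodule_hom_component[OF M x]] by simp
    then show "hom_component n (f (hom_component k x)) = (if k = n then f (hom_component n x) else 0)"
      by (auto simp: hom_component_id hom_component_eq_0)
  qed
  also have "\<dots> = f (hom_component n x)"
  proof (cases "n \<in> N")
    case False
    have "hom_component n x = (\<Sum>k\<in>N. hom_component n (hom_component k x))"
      by (subst N(2)) (simp add: hom_component_sum)
    also have "\<dots> = 0"
      using False by (intro sum.neutral) (metis free_homogeneous_hom_component hom_component_eq_0)
    finally show ?thesis
      using N(1) False by (simp add: graded_map_zero)
  qed (use N(1) in simp)
  finally show ?thesis ..
qed

lemma graded_submodule_kernel: "graded_submodule V {x \<in> M. f x = 0}"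
  using M graded_map_zero graded_map_add[OF f] graded_map_scale[OF f] graded_map_hom_component
  by (auto simp: graded_submodule_def)

end

text \<open>
  The degree is an integer so that lowering it never needs a side condition: pieces of negative degree
  contain nothing but \<open>0\<close>.
\<close>

definition degree_piece :: "('v, 'k::zero) free_elem set \<Rightarrow> int \<Rightarrow> ('v, 'k) free_elem set" where
  "degree_piece M q = {x \<in> M. \<forall>e m. fcoeff x e m \<noteq> 0 \<longrightarrow> int (mdeg m + fst e) = q}"

lemma degree_pieceD: "x \<in> degree_piece M q \<Longrightarrow> fcoeff x e m \<noteq> 0 \<Longrightarrow> int (mdeg m + fst e) = q"
  unfolding degree_piece_def by blast

lemma degree_pieceI: "x \<in> M \<Longrightarrow> (\<And>e m. fcoeff x e m \<noteq> 0 \<Longrightarrow> int (mdeg m + fst e) = q) \<Longrightarrow> x \<in> degree_piece M q"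
  unfolding degree_piece_def by blast

lemma degree_piece_subset: "x \<in> degree_piece M q \<Longrightarrow> x \<in> M"
  unfolding degree_piece_def by blast

lemma degree_piece_mono: "M \<subseteq> N \<Longrightarrow> x \<in> degree_piece M q \<Longrightarrow> x \<in> degree_piece N q"
  unfolding degree_piece_def by blast

lemma degree_piece_of_nat: "degree_piece M (int n) = {x \<in> M. free_homogeneous n x}"
  unfolding degree_piece_def free_homogeneous_iff of_nat_eq_iff ..

lemma degree_piece_neg: "x \<in> degree_piece M q \<Longrightarrow> q < 0 \<Longrightarrow> x = 0"
  by (rule free_elem_eqI) (force dest: degree_pieceD)

lemma degree_piece_zero: "graded_submodule V M \<Longrightarrow> 0 \<in> degree_piece M q"
  by (auto simp: degree_piece_def graded_submodule_zero)

lemma degree_piece_add: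
  assumes "graded_submodule V M" "x \<in> degree_piece M q" "y \<in> degree_piece M q"
  shows "x + y \<in> degree_piece M q"
proof (rule degree_pieceI)
  fix e m assume "fcoeff (x + y) e m \<noteq> 0"
  then have "fcoeff x e m \<noteq> 0 \<or> fcoeff y e m \<noteq> 0"
    by (auto simp: fcoeff_add)
  then show "int (mdeg m + fst e) = q"
    using assms(2,3) degree_pieceD by blast
qed (use assms in \<open>auto intro: graded_submodule_add degree_piece_subset\<close>)

lemma degree_piece_uminus:
  assumes "graded_submodule V M" "x \<in> degree_piece M q"
  shows "- x \<in> degree_piece M q"
proof (rule degree_pieceI)
  fix e m assume "fcoeff (- x) e m \<noteq> 0"
  then show "int (mdeg m + fst e) = q"
    using degree_pieceD[OF assms(2), of e m] by (simp add: fcoeff_uminus)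
qed (use assms in \<open>auto intro: graded_submodule_uminus degree_piece_subset\<close>)

lemma degree_piece_diff:
  "graded_submodule V M \<Longrightarrow> x \<in> degree_piece M q \<Longrightarrow> y \<in> degree_piece M q \<Longrightarrow> x - y \<in> degree_piece M q"
  using degree_piece_add[of V M x q "- y"] degree_piece_uminus[of V M y q] by simp

lemma degree_piece_sum:
  "graded_submodule V M \<Longrightarrow> (\<And>a. a \<in> A \<Longrightarrow> f a \<in> degree_piece M q) \<Longrightarrow> sum f A \<in> degree_piece M q"
  by (induction A rule: infinite_finite_induct) (auto intro: degree_piece_zero degree_piece_add)

lemma mdeg_diff_single:
  fixes m :: "'v \<Rightarrow>\<^sub>0 nat"
  assumes "v \<in> Poly_Mapping.keys m"
  shows "m = Poly_Mapping.single v 1 + (m - Poly_Mapping.single v 1)"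
  using assms
  by (intro poly_mapping_eqI) (auto simp: lookup_add lookup_minus lookup_single when_def in_keys_iff not_le)

lemma degree_piece_scale_var:
  assumes "graded_submodule V M" "v \<in> V" "x \<in> degree_piece M q"
  shows "scale (var v) x \<in> degree_piece M (q + 1)"
proof (rule degree_pieceI)
  fix e m assume "fcoeff (scale (var v) x) e m \<noteq> 0"
  then have v: "v \<in> Poly_Mapping.keys m" and x: "fcoeff x e (m - Poly_Mapping.single v 1) \<noteq> 0"
    by (auto simp: fcoeff_scale_var split: if_splits)
  have "mdeg m = 1 + mdeg (m - Poly_Mapping.single v 1)"
    by (subst mdeg_diff_single[OF v]) (simp add: mdeg_add)
  then show "int (mdeg m + fst e) = q + 1"
    using degree_pieceD[OF assms(3) x] by simp
qed (use assms in \<open>auto intro: graded_submodule_scale poly_ring_var degree_piece_subset\<close>)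

lemma degree_piece_graded_map:
  assumes "graded_submodule V M" "graded_map V M f" "f ` M \<subseteq> N" "x \<in> degree_piece M q"
  shows "f x \<in> degree_piece N q"
proof (cases "q < 0")
  case True
  then have "x = 0"
    using assms(4) degree_piece_neg by blast
  then have "f x = 0" "0 \<in> N"
    using assms(1,2,3) graded_map_zero graded_submodule_zero by (metis, metis image_subset_iff)
  then show ?thesis
    by (auto simp: degree_piece_def)
next
  case False
  then obtain n where q: "q = int n"
    using zero_le_imp_eq_int[of q] by auto
  show ?thesis
    using assms(3,4) graded_map_homogeneous[OF assms(2), of x n]
    unfolding q degree_piece_of_nat by blast
qed

text \<open>
  Taking a homogeneous component of any preimage gives a preimage of the right degree. The extra
  clause for \<open>0\<close> lets a chain be lifted without enlarging its support.
\<close>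

lemma degree_piece_lift:
  assumes "graded_submodule V M" "graded_map V M f" "f ` M = N" "y \<in> degree_piece N q"
  obtains x where "x \<in> degree_piece M q" "f x = y" "y = 0 \<Longrightarrow> x = 0"
proof (cases "y = 0")
  case True
  then show ?thesis
    using that[of 0] degree_piece_zero[OF assms(1)] graded_map_zero[OF assms(1,2)] by simp
next
  case False
  then obtain n where q: "q = int n"
    using degree_piece_neg[OF assms(4)] zero_le_imp_eq_int[of q] by force
  have "y \<in> N"
    using assms(4) degree_piece_subset by blast
  then obtain x where x: "x \<in> M" "f x = y"
    using assms(3) by blast
  have "free_homogeneous n y"
    using assms(4) by (simp add: q degree_piece_of_nat)
  then have "f (hom_component n x) = y"
    using x graded_map_hom_component[OF assms(1,2)] by (simp add: hom_component_id)
  moreover have "hom_component n x \<in> degree_piece M q"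
    using graded_submodule_hom_component[OF assms(1) x(1)] by (simp add: q degree_piece_of_nat)
  ultimately show ?thesis
    using that False by blast
qed

section \<open>Modules spanned by monomials\<close>

definition monomial_module :: "((nat \<times> nat) \<times> ('v \<Rightarrow>\<^sub>0 nat)) set \<Rightarrow> ('v, 'k::zero) free_elem set" where
  "monomial_module A = {x. \<forall>e m. fcoeff x e m \<noteq> 0 \<longrightarrow> (e, m) \<in> A}"

lemma monomial_moduleD: "x \<in> monomial_module A \<Longrightarrow> fcoeff x e m \<noteq> 0 \<Longrightarrow> (e, m) \<in> A"
  unfolding monomial_module_def by blast

lemma monomial_moduleI: "(\<And>e m. fcoeff x e m \<noteq> 0 \<Longrightarrow> (e, m) \<in> A) \<Longrightarrow> x \<in> monomial_module A"
  unfolding monomial_module_def by blast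

lemma graded_submodule_monomial_module:
  assumes A: "\<And>e m a. (e, m) \<in> A \<Longrightarrow> Poly_Mapping.keys a \<subseteq> V \<Longrightarrow> (e, a + m) \<in> A"
  shows "graded_submodule V (monomial_module A :: ('v, 'k::comm_ring_1) free_elem set)"
  unfolding graded_submodule_def
proof (intro conjI ballI allI)
  fix x y :: "('v, 'k) free_elem" assume xy: "x \<in> monomial_module A" "y \<in> monomial_module A"
  show "x + y \<in> monomial_module A"
  proof (rule monomial_moduleI)
    fix e m assume "fcoeff (x + y) e m \<noteq> 0"
    then have "fcoeff x e m \<noteq> 0 \<or> fcoeff y e m \<noteq> 0"
      by (auto simp: fcoeff_add)
    then show "(e, m) \<in> A"
      using xy monomial_moduleD by blast
  qed
next
  fix p :: "('v, 'k) mpoly" and x :: "('v, 'k) free_elem" assume p: "p \<in> poly_ring V" and x: "x \<in> monomial_module A"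
  show "scale p x \<in> monomial_module A"
  proof (rule monomial_moduleI)
    fix e m assume "fcoeff (scale p x) e m \<noteq> 0"
    then have "m \<in> Poly_Mapping.keys (p * Poly_Mapping.lookup x e)"
      by (simp add: fcoeff_def lookup_scale in_keys_iff)
    then obtain c d where cd: "m = c + d" "c \<in> Poly_Mapping.keys p" "d \<in> Poly_Mapping.keys (Poly_Mapping.lookup x e)"
      using keys_mult[of p "Poly_Mapping.lookup x e"] by auto
    then have "(e, d) \<in> A" "Poly_Mapping.keys c \<subseteq> V"
      using x p by (auto simp: in_keys_lookup_iff poly_ring_def dest: monomial_moduleD)
    then show "(e, m) \<in> A"
      using A cd by simp
  qed
next
  fix n and x :: "('v, 'k) free_elem" assume x: "x \<in> monomial_module A"
  show "hom_component n x \<in> monomial_module A"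
    by (rule monomial_moduleI) (auto simp: fcoeff_hom_component split: if_splits intro: monomial_moduleD[OF x])
qed (simp add: monomial_module_def)

definition free_monomials :: "'v set \<Rightarrow> (nat \<Rightarrow> nat) \<Rightarrow> ((nat \<times> nat) \<times> ('v \<Rightarrow>\<^sub>0 nat)) set" where
  "free_monomials V b = {(e, m). snd e < b (fst e) \<and> Poly_Mapping.keys m \<subseteq> V}"

lemma graded_free_eq_monomial_module: "graded_free V b = monomial_module (free_monomials V b)"
  unfolding monomial_module_def free_monomials_def set_eq_iff graded_free_iff by simp

lemma graded_submodule_graded_free: "graded_submodule V (graded_free V b)"
  unfolding graded_free_eq_monomial_module
  by (rule graded_submodule_monomial_module) (auto simp: free_monomials_def keys_add_nat)

lemma finite_free_monomials:
  assumes "finite V"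
  shows "finite {(e, m) \<in> free_monomials V b. int (mdeg m + fst e) = q}"
proof (rule finite_subset)
  let ?E = "Sigma {..nat q} (\<lambda>j. {..<b j})"
  show "{(e, m) \<in> free_monomials V b. int (mdeg m + fst e) = q}
      \<subseteq> ?E \<times> {m. Poly_Mapping.keys m \<subseteq> V \<and> mdeg m \<le> nat q}"
    by (auto simp: free_monomials_def)
  show "finite (?E \<times> {m. Poly_Mapping.keys m \<subseteq> V \<and> mdeg m \<le> nat q})"
    using finite_monomials[OF assms] by auto
qed

section \<open>Existence of minimal free resolutions\<close>

definition kscale :: "'k::field \<Rightarrow> ('v, 'k) free_elem \<Rightarrow> ('v, 'k) free_elem" where
  "kscale a = scale (Poly_Mapping.single 0 a)"

lemma fcoeff_kscale: "fcoeff (kscale a x) e m = a * fcoeff x e m"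
  unfolding kscale_def fcoeff_def lookup_scale mult_map_scale_conv_mult[symmetric]
  by (simp add: map.rep_eq when_def)

text \<open>
  Minimal generators in a fixed degree are found by linear algebra over the ground field.
\<close>

interpretation free_elem: vector_space kscale
  by unfold_locales (auto intro!: free_elem_eqI simp: fcoeff_kscale fcoeff_add algebra_simps)

lemma kscale_graded_submodule: "graded_submodule V M \<Longrightarrow> x \<in> M \<Longrightarrow> kscale a x \<in> M"
  unfolding kscale_def by (rule graded_submodule_scale) (auto intro: poly_ring_single)

lemma subspace_graded_submodule: "graded_submodule V M \<Longrightarrow> free_elem.subspace M"
  by (auto simp: free_elem.subspace_def graded_submodule_zero graded_submodule_add kscale_graded_submodule)

lemma subspace_homogeneous:
  assumes "graded_submodule V M" shows "free_elem.subspace {x \<in> M. free_homogeneous n x}"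
proof -
  have "free_homogeneous n (kscale a x)" if "free_homogeneous n x" for a x
    using that by (intro free_homogeneousI) (auto simp: fcoeff_kscale dest: free_homogeneousD)
  then show ?thesis
    using assms
    by (auto simp: free_elem.subspace_def graded_submodule_zero graded_submodule_add
        kscale_graded_submodule free_homogeneous_add)
qed

lemma homogeneous_finite_span:
  fixes b :: "nat \<Rightarrow> nat"
  assumes "finite V"
  obtains T :: "('v, 'k::field) free_elem set" where "finite T"
    "{x \<in> graded_free V b. free_homogeneous n x} \<subseteq> free_elem.span T"
proof
  let ?B = "{(e, m) \<in> free_monomials V b. int (mdeg m + fst e) = int n}"
  let ?x = "\<lambda>(e, m). Poly_Mapping.single e (Poly_Mapping.single m 1) :: ('v, 'k) free_elem"
  have B: "finite ?B"
    by (rule finite_free_monomials[OF assms])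
  then show "finite (?x ` ?B)"
    by (rule finite_imageI)
  show "{x \<in> graded_free V b. free_homogeneous n x} \<subseteq> free_elem.span (?x ` ?B)"
  proof
    fix x :: "('v, 'k) free_elem" assume x: "x \<in> {x \<in> graded_free V b. free_homogeneous n x}"
    have "x = (\<Sum>y\<in>?B. kscale (fcoeff x (fst y) (snd y)) (?x y))" (is "x = ?s")
    proof (rule free_elem_eqI)
      fix e m
      have "fcoeff ?s e m = (\<Sum>y\<in>?B. if y = (e, m) then fcoeff x e m else 0)"
        unfolding fcoeff_sum
        by (rule sum.cong) (auto simp: fcoeff_kscale fcoeff_single split: if_splits)
      also have "\<dots> = (if (e, m) \<in> ?B then fcoeff x e m else 0)"
        using B by simp
      also have "\<dots> = fcoeff x e m"
      proof (cases "fcoeff x e m = 0")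
        case False
        have "free_homogeneous n x" "x \<in> graded_free V b"
          using x by auto
        then have "(e, m) \<in> ?B"
          using False free_homogeneousD[of n x e m] monomial_moduleD[of x "free_monomials V b" e m]
          by (auto simp: graded_free_eq_monomial_module)
        then show ?thesis
          by simp
      qed simp
      finally show "fcoeff x e m = fcoeff ?s e m" ..
    qed
    also have "\<dots> \<in> free_elem.span (?x ` ?B)"
      by (intro free_elem.span_sum free_elem.span_scale free_elem.span_base imageI)
    finally show "x \<in> free_elem.span (?x ` ?B)" .
  qed
qed

text \<open>
  For a graded submodule, this is the degree \<open>n\<close> part of \<open>\<mm> M\<close>, where \<open>\<mm>\<close> is the ideal generated by the variables.
\<close>

definition decomposables :: "'v set \<Rightarrow> ('v, 'k::field) free_elem set \<Rightarrow> nat \<Rightarrow> ('v, 'k) free_elem set" where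
  "decomposables V M n =
    free_elem.span {scale (var v) y | v y k. v \<in> V \<and> y \<in> M \<and> free_homogeneous k y \<and> k + 1 = n}"

lemma decomposables_subset:
  assumes "graded_submodule V M"
  shows "decomposables V M n \<subseteq> {x \<in> M. free_homogeneous n x}"
  unfolding decomposables_def
proof (rule free_elem.span_minimal[OF _ subspace_homogeneous[OF assms]])
  have "free_homogeneous (k + 1) (scale (var v) y)" if "free_homogeneous k y" for k v and y :: "('a, 'b) free_elem"
    using free_homogeneous_scale[OF homogeneous_var that, of v] by (simp add: add.commute)
  then show "{scale (var v) y |v y k. v \<in> V \<and> y \<in> M \<and> free_homogeneous k y \<and> k + 1 = n}
    \<subseteq> {x \<in> M. free_homogeneous n x}"
    using assms by (fastforce intro: graded_submodule_scale poly_ring_var)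
qed

lemma scale_in_decomposables:
  fixes z :: "('v, 'k::field) free_elem"
  assumes M: "graded_submodule V M" and p: "p \<in> poly_ring V" "homogeneous d p" "d > 0"
    and z: "z \<in> M" "free_homogeneous k z" and n: "n = d + k"
  shows "scale p z \<in> decomposables V M n"
proof -
  have "scale (Poly_Mapping.single m a) z \<in> decomposables V M n"
    if m: "m \<in> Poly_Mapping.keys p" for m a
  proof -
    have md: "mdeg m = d" "Poly_Mapping.keys m \<subseteq> V"
      using p m by (auto simp: homogeneous_def poly_ring_def)
    then have "m \<noteq> 0"
      using p(3) by auto
    then obtain v where v: "v \<in> Poly_Mapping.keys m"
      by (metis in_keys_iff lookup_zero poly_mapping_eqI)
    define m' where "m' = m - Poly_Mapping.single v 1"
    have m': "m = Poly_Mapping.single v 1 + m'"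
      unfolding m'_def by (rule mdeg_diff_single[OF v])
    have "Poly_Mapping.single m a = var v * Poly_Mapping.single m' a"
      by (subst m') (simp add: var_def mult_single)
    then have eq: "scale (Poly_Mapping.single m a) z = scale (var v) (scale (Poly_Mapping.single m' a) z)"
      by (simp add: scale_scale)
    have km': "Poly_Mapping.keys m' \<subseteq> V"
      using md(2) m' by (metis Un_subset_iff keys_add_nat)
    have "mdeg m' + 1 = d"
      using md(1) m' by (metis add.commute mdeg_add mdeg_single)
    moreover have "homogeneous (mdeg m') (Poly_Mapping.single m' a)"
      by (auto simp: homogeneous_def)
    from free_homogeneous_scale[OF this z(2)]
    have "free_homogeneous (mdeg m' + k) (scale (Poly_Mapping.single m' a) z)" .
    ultimately show ?thesis
      unfolding eq decomposables_def
      using v md(2) n graded_submodule_scale[OF M poly_ring_single[OF km'] z(1), of a]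
      by (intro free_elem.span_base CollectI exI[of _ v] exI[of _ "scale (Poly_Mapping.single m' a) z"]
            exI[of _ "mdeg m' + k"]) auto
  qed
  then show ?thesis
    by (subst sum_monomials[of p]) (auto simp: scale_sum_left decomposables_def intro: free_elem.span_sum)
qed

text \<open>
  A basis of the decomposable part is extended to a basis of the whole degree \<open>n\<close> part; the
  vectors added are the generators. The last clause says that they are independent modulo
  decomposables, which is what makes the resolution minimal.
\<close>

lemma minimal_generators_in_degree:
  fixes M :: "('v, 'k::field) free_elem set"
  assumes V: "finite V" and M: "graded_submodule V M" "M \<subseteq> graded_free V b"
  obtains G where "finite G" "G \<subseteq> {x \<in> M. free_homogeneous n x}"
    "{x \<in> M. free_homogeneous n x} \<subseteq> {x + y | x y. x \<in> decomposables V M n \<and> y \<in> free_elem.span G}"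
    "\<And>u z. (\<Sum>g\<in>G. kscale (u g) g) \<in> decomposables V M n \<Longrightarrow> z \<in> G \<Longrightarrow> u z = 0"
proof -
  let ?P = "{x \<in> M. free_homogeneous n x}" and ?U = "decomposables V M n"
  obtain B0 where B0: "B0 \<subseteq> ?U" "free_elem.independent B0" "?U \<subseteq> free_elem.span B0"
    using free_elem.maximal_independent_subset by blast
  then have "B0 \<subseteq> ?P"
    using decomposables_subset[OF M(1)] by blast
  then obtain B where B: "B0 \<subseteq> B" "B \<subseteq> ?P" "free_elem.independent B" "?P \<subseteq> free_elem.span B"
    using free_elem.maximal_independent_subset_extend[OF _ B0(2)] by blast
  obtain T :: "('v, 'k) free_elem set"
    where T: "finite T" "{x \<in> graded_free V b. free_homogeneous n x} \<subseteq> free_elem.span T"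
    using homogeneous_finite_span[OF V] by blast
  have "finite B"
    using free_elem.independent_span_bound[OF T(1) B(3)] B(2) M(2) T(2) by blast
  show ?thesis
  proof (rule that[of "B - B0"])
    show "finite (B - B0)"
      using \<open>finite B\<close> by simp
    show "B - B0 \<subseteq> ?P"
      using B(2) by blast
    have "free_elem.span B0 = ?U"
      using B0(1,3) free_elem.span_subspace[OF B0(1,3)] by (simp add: decomposables_def)
    moreover have "free_elem.span B = {x + y | x y. x \<in> free_elem.span B0 \<and> y \<in> free_elem.span (B - B0)}"
      using B(1) free_elem.span_Un[of B0 "B - B0"] by (simp add: Un_absorb1)
    ultimately show "?P \<subseteq> {x + y | x y. x \<in> ?U \<and> y \<in> free_elem.span (B - B0)}"
      using B(4) by simp
    fix u z assume u: "(\<Sum>g\<in>B - B0. kscale (u g) g) \<in> ?U" and z: "z \<in> B - B0"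
    have "finite B0"
      using B(1) \<open>finite B\<close> finite_subset by blast
    then obtain c where c: "(\<Sum>g\<in>B - B0. kscale (u g) g) = (\<Sum>g\<in>B0. kscale (c g) g)"
      using u B0(3) free_elem.span_finite[of B0] by auto
    \<comment> \<open>A combination of new vectors that is decomposable gives a linear relation in the whole basis.\<close>
    define w where "w g = (if g \<in> B0 then - c g else u g)" for g
    have "(\<Sum>g\<in>B. kscale (w g) g) = (\<Sum>g\<in>B - B0. kscale (w g) g) + (\<Sum>g\<in>B0. kscale (w g) g)"
      using \<open>finite B\<close> B(1) by (simp add: sum.subset_diff add.commute)
    also have "(\<Sum>g\<in>B - B0. kscale (w g) g) = (\<Sum>g\<in>B - B0. kscale (u g) g)"
      by (rule sum.cong) (auto simp: w_def)
    also have "(\<Sum>g\<in>B0. kscale (w g) g) = - (\<Sum>g\<in>B0. kscale (c g) g)"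
      unfolding sum_negf[symmetric] by (rule sum.cong) (auto simp: w_def free_elem.scale_minus_left)
    finally have "(\<Sum>g\<in>B. kscale (w g) g) = 0"
      by (simp add: c)
    then have "w z = 0"
      using free_elem.independentD[OF B(3) \<open>finite B\<close> subset_refl, of w z] z by simp
    then show "u z = 0"
      using z by (simp add: w_def)
  qed
qed

text \<open>
  The \<open>R\<close>-linear map that sends the basis element \<open>e\<close> to \<open>g e\<close>.
\<close>

definition free_extension ::
  "(nat \<times> nat \<Rightarrow> ('v, 'k::comm_ring_1) free_elem) \<Rightarrow> ('v, 'k) free_elem \<Rightarrow> ('v, 'k) free_elem" where
  "free_extension g x = (\<Sum>e\<in>Poly_Mapping.keys x. scale (Poly_Mapping.lookup x e) (g e))"

lemma free_extension_superset:
  "finite T \<Longrightarrow> Poly_Mapping.keys x \<subseteq> T \<Longrightarrow>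
    free_extension g x = (\<Sum>e\<in>T. scale (Poly_Mapping.lookup x e) (g e))"
  unfolding free_extension_def by (rule sum.mono_neutral_left) (auto simp: in_keys_iff)

lemma free_extension_single: "free_extension g (Poly_Mapping.single e 1) = g e"
  by (subst free_extension_superset[of "{e}"]) auto

lemma lookup_graded_free:
  "x \<in> graded_free V b \<Longrightarrow> Poly_Mapping.lookup x e \<in> poly_ring V"
  by (cases "e \<in> Poly_Mapping.keys x") (auto simp: graded_free_def in_keys_iff poly_ring_zero)

lemma graded_map_free_extension:
  fixes g :: "nat \<times> nat \<Rightarrow> ('v, 'k::comm_ring_1) free_elem"
  assumes "\<And>j k. k < b j \<Longrightarrow> free_homogeneous j (g (j, k))"
  shows "graded_map V (graded_free V b) (free_extension g)"
  unfolding graded_map_def linear_over_def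
proof (intro conjI ballI allI impI)
  fix x y :: "('v, 'k) free_elem"
  let ?T = "Poly_Mapping.keys x \<union> Poly_Mapping.keys y"
  have "free_extension g (x + y) = (\<Sum>e\<in>?T. scale (Poly_Mapping.lookup (x + y) e) (g e))"
    by (rule free_extension_superset) (use keys_add[of x y] in auto)
  then show "free_extension g (x + y) = free_extension g x + free_extension g y"
    by (simp add: free_extension_superset[of ?T] lookup_add scale_add_left sum.distrib)
next
  fix p :: "('v, 'k) mpoly" and x :: "('v, 'k) free_elem"
  have "Poly_Mapping.keys (scale p x) \<subseteq> Poly_Mapping.keys x"
    by (auto simp: in_keys_iff lookup_scale)
  then show "free_extension g (scale p x) = scale p (free_extension g x)"
    by (simp add: free_extension_superset[of "Poly_Mapping.keys x"] lookup_scale scale_sum_right scale_scale)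
next
  fix n and x :: "('v, 'k) free_elem" assume x: "x \<in> graded_free V b" "free_homogeneous n x"
  show "free_homogeneous n (free_extension g x)"
    unfolding free_extension_def
  proof (rule free_homogeneous_sum)
    fix e assume e: "e \<in> Poly_Mapping.keys x"
    then obtain m where "fcoeff x e m \<noteq> 0"
      by (rule in_keys_fcoeffE)
    then have "mdeg m + fst e = n" and "snd e < b (fst e)"
      using free_homogeneousD[OF x(2)] x(1) unfolding graded_free_iff by blast+
    then have n: "n = (n - fst e) + fst e" and g: "free_homogeneous (fst e) (g e)"
      using assms[of "snd e" "fst e"] by auto
    have "homogeneous (n - fst e) (Poly_Mapping.lookup x e)"
      unfolding homogeneous_def using free_homogeneousD[OF x(2)] by (fastforce simp: in_keys_lookup_iff)
    from free_homogeneous_scale[OF this g] show "free_homogeneous n (scale (Poly_Mapping.lookup x e) (g e))"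
      using n by simp
  qed
qed

lemma graded_submodule_image:
  fixes M :: "('v, 'k::comm_ring_1) free_elem set"
  assumes "graded_submodule V M" "graded_map V M f"
  shows "graded_submodule V (f ` M)"
  unfolding graded_submodule_def
proof (intro conjI ballI allI)
  show "0 \<in> f ` M"
    using graded_map_zero[OF assms] graded_submodule_zero[OF assms(1)] by force
next
  fix x y assume "x \<in> f ` M" "y \<in> f ` M"
  then show "x + y \<in> f ` M"
    using graded_map_add[OF assms(2)] graded_submodule_add[OF assms(1)] by (smt (verit) image_iff)
next
  fix p :: "('v, 'k) mpoly" and x assume "p \<in> poly_ring V" "x \<in> f ` M"
  then show "scale p x \<in> f ` M"
    using graded_map_scale[OF assms(2)] graded_submodule_scale[OF assms(1)] by (smt (verit) image_iff)
next
  fix n x assume "x \<in> f ` M"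
  then show "hom_component n x \<in> f ` M"
    using graded_map_hom_component[OF assms] graded_submodule_hom_component[OF assms(1)] by (smt (verit) image_iff)
qed

text \<open>
  The free module on the minimal generators of all degrees maps onto \<open>M\<close> by induction on the degree,
  since a decomposable element comes from lower degrees. In an element of the kernel, the degree
  \<open>n\<close> component gives a relation in which the generators of degree \<open>n\<close> appear with scalar
  coefficients and all lower generators with coefficients of positive degree. The latter terms are
  decomposable, so the scalars vanish by independence modulo decomposables.
\<close>

lemma minimal_free_cover:
  fixes M :: "('v, 'k::field) free_elem set"
  assumes V: "finite V" and M: "graded_submodule V M" "M \<subseteq> graded_free V b"
  obtains b' f where "graded_map V (graded_free V b') f" "f ` graded_free V b' = M"
    "\<And>x e. x \<in> graded_free V b' \<Longrightarrow> f x = 0 \<Longrightarrow> fcoeff x e 0 = 0"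
proof -
  let ?P = "\<lambda>n. {x \<in> M. free_homogeneous n x}" and ?U = "decomposables V M"
  define generates where "generates n G \<longleftrightarrow> finite G \<and> G \<subseteq> ?P n \<and>
      ?P n \<subseteq> {x + y | x y. x \<in> ?U n \<and> y \<in> free_elem.span G} \<and>
      (\<forall>u z. (\<Sum>g\<in>G. kscale (u g) g) \<in> ?U n \<longrightarrow> z \<in> G \<longrightarrow> u z = 0)" for n G
  have "\<forall>n. \<exists>G. generates n G"
    unfolding generates_def
  proof
    fix n
    show "\<exists>G. finite G \<and> G \<subseteq> ?P n \<and>
      ?P n \<subseteq> {x + y | x y. x \<in> ?U n \<and> y \<in> free_elem.span G} \<and>
      (\<forall>u z. (\<Sum>g\<in>G. kscale (u g) g) \<in> ?U n \<longrightarrow> z \<in> G \<longrightarrow> u z = 0)"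
      by (rule minimal_generators_in_degree[OF V M, of n]) blast
  qed
  then obtain G where "\<And>n. generates n (G n)"
    using choice[of generates] by blast
  then have G: "finite (G n)" "G n \<subseteq> ?P n"
    "?P n \<subseteq> {x + y | x y. x \<in> ?U n \<and> y \<in> free_elem.span (G n)}"
    "(\<Sum>g\<in>G n. kscale (u g) g) \<in> ?U n \<Longrightarrow> z \<in> G n \<Longrightarrow> u z = 0" for n u z
    unfolding generates_def by blast+
  have "\<exists>h. bij_betw h {..<card (G n)} (G n)" for n
    using ex_bij_betw_nat_finite[OF G(1)[of n]] by (simp add: atLeast0LessThan)
  then obtain h where h: "\<And>n. bij_betw (h n) {..<card (G n)} (G n)"
    by metis
  define b' where "b' n = card (G n)" for n
  define g where "g e = h (fst e) (snd e)" for e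
  let ?F = "graded_free V b' :: ('v, 'k) free_elem set" and ?f = "free_extension g"
  have g: "g (n, k) \<in> G n" if "k < b' n" for n k
    using bij_betw_apply[OF h[of n], of k] that by (simp add: g_def b'_def)
  then have gP: "g (n, k) \<in> M" "free_homogeneous n (g (n, k))" if "k < b' n" for n k
    using that G(2)[of n] by blast+
  have f: "graded_map V ?F ?f"
    by (rule graded_map_free_extension) (rule gP)
  have F: "graded_submodule V ?F"
    by (rule graded_submodule_graded_free)
  have "?f x \<in> M" if x: "x \<in> ?F" for x
    unfolding free_extension_def
  proof (rule graded_submodule_sum[OF M(1)])
    fix e assume "e \<in> Poly_Mapping.keys x"
    then have "snd e < b' (fst e)"
      using x unfolding graded_free_def by auto
    then have "g e \<in> M"
      using gP(1)[of "snd e" "fst e"] by simp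
    then show "scale (Poly_Mapping.lookup x e) (g e) \<in> M"
      using lookup_graded_free[OF x] by (intro graded_submodule_scale[OF M(1)])
  qed
  moreover have surj: "?P n \<subseteq> ?f ` ?F" for n
  proof (induction n rule: less_induct)
    case (less n)
    have R: "graded_submodule V (?f ` ?F)"
      by (rule graded_submodule_image[OF F f])
    have "?U n \<subseteq> ?f ` ?F"
      unfolding decomposables_def
    proof (rule free_elem.span_minimal[OF _ subspace_graded_submodule[OF R]])
      show "{scale (var v) y |v y k. v \<in> V \<and> y \<in> M \<and> free_homogeneous k y \<and> k + 1 = n} \<subseteq> ?f ` ?F"
        using less by (auto intro!: graded_submodule_scale[OF R] poly_ring_var)
    qed
    moreover have "G n \<subseteq> ?f ` ?F"
    proof
      fix z assume "z \<in> G n"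
      then obtain k where k: "k < b' n" "z = g (n, k)"
        using bij_betw_imp_surj_on[OF h[of n]] by (auto simp: g_def b'_def)
      have "Poly_Mapping.single (n, k) 1 \<in> ?F"
        using k(1) by (auto simp: graded_free_def poly_ring_one lookup_single when_def)
      moreover have "?f (Poly_Mapping.single (n, k) 1) = z"
        by (simp add: free_extension_single k)
      ultimately show "z \<in> ?f ` ?F"
        by blast
    qed
    then have "free_elem.span (G n) \<subseteq> ?f ` ?F"
      by (rule free_elem.span_minimal[OF _ subspace_graded_submodule[OF R]])
    ultimately have *: "a + c \<in> ?f ` ?F" if "a \<in> ?U n" "c \<in> free_elem.span (G n)" for a c
      using that by (intro graded_submodule_add[OF R]) (erule (1) subsetD)+
    show ?case
    proof
      fix x assume "x \<in> ?P n"
      then obtain a c where "x = a + c" "a \<in> ?U n" "c \<in> free_elem.span (G n)"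
        using G(3)[of n] by blast
      then show "x \<in> ?f ` ?F"
        using * by simp
    qed
  qed
  have "x \<in> ?f ` ?F" if x: "x \<in> M" for x
  proof -
    obtain N where "x = (\<Sum>n\<in>N. hom_component n x)"
      using sum_hom_component by blast
    moreover have "hom_component n x \<in> ?f ` ?F" for n
      using surj[of n] graded_submodule_hom_component[OF M(1) x] by auto
    ultimately show ?thesis
      using graded_submodule_sum[OF graded_submodule_image[OF F f], of N "\<lambda>n. hom_component n x"] by simp
  qed
  ultimately have image: "?f ` ?F = M"
    by blast
  have "fcoeff x e 0 = 0" if x: "x \<in> ?F" "?f x = 0" for x e
  proof (rule ccontr)
    assume nz: "fcoeff x e 0 \<noteq> 0"
    define n where "n = fst e"
    define k where "k = snd e"
    have e: "e = (n, k)"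
      by (simp add: n_def k_def)
    have k: "k < b' n"
      using nz x(1) unfolding graded_free_iff by (auto simp: e)
    define y where "y = hom_component n x"
    have y: "y \<in> ?F" "free_homogeneous n y"
      using graded_submodule_hom_component[OF F x(1)] by (auto simp: y_def)
    have fy: "?f y = 0"
      using graded_map_hom_component[OF F f x(1), of n] x(2) by (simp add: y_def)
    let ?T1 = "(\<lambda>k. (n, k)) ` {..<b' n}" and ?T2 = "{e \<in> Poly_Mapping.keys y. fst e < n}"
    let ?s = "\<lambda>e. scale (Poly_Mapping.lookup y e) (g e)"
    have keys_y: "fst e \<le> n \<and> snd e < b' (fst e)" if ey: "e \<in> Poly_Mapping.keys y" for e
    proof -
      obtain m where m: "fcoeff y e m \<noteq> 0"
        using ey by (rule in_keys_fcoeffE)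
      then have "snd e < b' (fst e)"
        using y(1) unfolding graded_free_iff by blast
      then show ?thesis
        using free_homogeneousD[OF y(2) m] by simp
    qed
    have "Poly_Mapping.keys y \<subseteq> ?T1 \<union> ?T2"
    proof
      fix e assume e: "e \<in> Poly_Mapping.keys y"
      with keys_y[OF e] show "e \<in> ?T1 \<union> ?T2"
        by (cases e) (auto simp: le_less)
    qed
    then have "?f y = (\<Sum>e\<in>?T1 \<union> ?T2. ?s e)"
      by (intro free_extension_superset) auto
    also have "\<dots> = (\<Sum>e\<in>?T1. ?s e) + (\<Sum>e\<in>?T2. ?s e)"
      by (rule sum.union_disjoint) auto
    finally have "(\<Sum>e\<in>?T1. ?s e) = - (\<Sum>e\<in>?T2. ?s e)"
      by (simp add: fy eq_neg_iff_add_eq_0)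
    moreover have "(\<Sum>e\<in>?T2. ?s e) \<in> ?U n"
      unfolding decomposables_def
    proof (rule free_elem.span_sum, fold decomposables_def)
      fix e assume e: "e \<in> ?T2"
      then have ge: "g e \<in> M" "free_homogeneous (fst e) (g e)"
        using keys_y[of e] gP[of "snd e" "fst e"] by auto
      have "homogeneous (n - fst e) (Poly_Mapping.lookup y e)"
        unfolding homogeneous_def using free_homogeneousD[OF y(2)] by (fastforce simp: in_keys_lookup_iff)
      then show "?s e \<in> ?U n"
        using e by (intro scale_in_decomposables[OF M(1) lookup_graded_free[OF y(1)] _ _ ge]) auto
    qed
    ultimately have "(\<Sum>e\<in>?T1. ?s e) \<in> ?U n"
      unfolding decomposables_def by (simp add: free_elem.span_neg)
    also have "(\<Sum>e\<in>?T1. ?s e) = (\<Sum>k<b' n. ?s (n, k))"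
      by (subst sum.reindex) (auto simp: inj_on_def)
    also have "\<dots> = (\<Sum>k<b' n. kscale (fcoeff x (n, k) 0) (h n k))"
    proof (rule sum.cong[OF refl])
      fix k
      have "Poly_Mapping.lookup y (n, k) = Poly_Mapping.single 0 (fcoeff x (n, k) 0)"
      proof (rule poly_mapping_eqI)
        fix m
        show "Poly_Mapping.lookup (Poly_Mapping.lookup y (n, k)) m =
            Poly_Mapping.lookup (Poly_Mapping.single 0 (fcoeff x (n, k) 0)) m"
          using fcoeff_hom_component[of n x "(n, k)" m]
          by (auto simp: y_def fcoeff_def lookup_single when_def mdeg_eq_0_iff)
      qed
      then show "?s (n, k) = kscale (fcoeff x (n, k) 0) (h n k)"
        by (simp add: kscale_def g_def)
    qed
    also have "\<dots> = (\<Sum>z\<in>G n. kscale (fcoeff x (n, inv_into {..<b' n} (h n) z) 0) z)"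
      using h[of n] unfolding b'_def[symmetric]
      by (intro sum.reindex_bij_witness[where j = "h n" and i = "inv_into {..<b' n} (h n)"])
        (use inv_into_into[of _ "h n" "{..<b' n}"] in \<open>auto simp: bij_betw_def f_inv_into_f\<close>)
    finally have "fcoeff x (n, inv_into {..<b' n} (h n) (h n k)) 0 = 0"
      using G(4)[of "\<lambda>z. fcoeff x (n, inv_into {..<b' n} (h n) z) 0" n "h n k"] g[OF k]
      by (simp add: g_def)
    then show False
      using nz k h[of n] by (simp add: e b'_def bij_betw_def)
  qed
  then show ?thesis
    using that[OF f image] by blast
qed

text \<open>
  A resolution in which the augmentation is treated as one more map between free modules, so that
  all steps have the same shape. Minimality is stated on kernels, which by exactness are the images
  of the differentials.
\<close>

definition minimally_resolves ::
  "'v set \<Rightarrow> ('v, 'k::comm_ring_1) free_elem set \<Rightarrow> (nat \<Rightarrow> nat \<Rightarrow> nat) \<Rightarrow>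
    (nat \<Rightarrow> ('v, 'k) free_elem \<Rightarrow> ('v, 'k) free_elem) \<Rightarrow> bool" where
  "minimally_resolves V M b f \<longleftrightarrow>
    (\<forall>i. graded_map V (graded_free V (b i)) (f i)) \<and>
    f 0 ` graded_free V (b 0) = M \<and>
    (\<forall>i. f (Suc i) ` graded_free V (b (Suc i)) = {x \<in> graded_free V (b i). f i x = 0}) \<and>
    (\<forall>i. \<forall>x\<in>graded_free V (b i). f i x = 0 \<longrightarrow> (\<forall>e. fcoeff x e 0 = 0))"

lemma minimally_resolves_exists:
  fixes M :: "('v, 'k::field) free_elem set"
  assumes V: "finite V" and M: "graded_submodule V M" "M \<subseteq> graded_free V b"
  obtains bs fs where "minimally_resolves V M bs fs"
proof -
  define ker where "ker b f = {x \<in> graded_free V b. f x = 0}"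
    for b and f :: "('v, 'k) free_elem \<Rightarrow> ('v, 'k) free_elem"
  define P where "P bf \<longleftrightarrow> graded_map V (graded_free V (fst bf)) (snd bf) \<and>
    (\<forall>x\<in>ker (fst bf) (snd bf). \<forall>e. fcoeff x e 0 = 0)"
    for bf :: "(nat \<Rightarrow> nat) \<times> (('v, 'k) free_elem \<Rightarrow> ('v, 'k) free_elem)"
  obtain b0 f0 where bf0: "graded_map V (graded_free V b0) f0" "f0 ` graded_free V b0 = M"
    "\<And>x e. x \<in> graded_free V b0 \<Longrightarrow> f0 x = 0 \<Longrightarrow> fcoeff x e 0 = 0"
    using minimal_free_cover[OF V M] by blast
  have "\<exists>s. \<forall>i. (P (s i) \<and> (i = 0 \<longrightarrow> snd (s i) ` graded_free V (fst (s i)) = M)) \<and>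
      snd (s (Suc i)) ` graded_free V (fst (s (Suc i))) = ker (fst (s i)) (snd (s i))"
  proof (rule dependent_nat_choice)
    show "\<exists>bf. P bf \<and> ((0::nat) = 0 \<longrightarrow> snd bf ` graded_free V (fst bf) = M)"
      using bf0 by (intro exI[of _ "(b0, f0)"]) (auto simp: P_def ker_def)
  next
    fix bf and i :: nat
    assume bf: "P bf \<and> (i = 0 \<longrightarrow> snd bf ` graded_free V (fst bf) = M)"
    have "graded_submodule V (ker (fst bf) (snd bf))"
      unfolding ker_def using bf by (intro graded_submodule_kernel graded_submodule_graded_free) (simp add: P_def)
    moreover have "ker (fst bf) (snd bf) \<subseteq> graded_free V (fst bf)"
      by (auto simp: ker_def)
    ultimately obtain b' f' where "graded_map V (graded_free V b') f'"
      "f' ` graded_free V b' = ker (fst bf) (snd bf)"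
      "\<And>x e. x \<in> graded_free V b' \<Longrightarrow> f' x = 0 \<Longrightarrow> fcoeff x e 0 = 0"
      using minimal_free_cover[OF V] by blast
    then show "\<exists>bf'. (P bf' \<and> (Suc i = 0 \<longrightarrow> snd bf' ` graded_free V (fst bf') = M)) \<and>
        snd bf' ` graded_free V (fst bf') = ker (fst bf) (snd bf)"
      by (intro exI[of _ "(b', f')"]) (auto simp: P_def ker_def)
  qed
  then obtain s where s: "\<forall>i. (P (s i) \<and> (i = 0 \<longrightarrow> snd (s i) ` graded_free V (fst (s i)) = M)) \<and>
      snd (s (Suc i)) ` graded_free V (fst (s (Suc i))) = ker (fst (s i)) (snd (s i))" ..
  then have "minimally_resolves V M (\<lambda>i. fst (s i)) (\<lambda>i. snd (s i))"
    unfolding minimally_resolves_def P_def ker_def by simp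
  then show ?thesis
    using that by blast
qed

section \<open>Koszul complexes\<close>

text \<open>
  The signs of the Koszul complex need a linear order on the vertices; it is supplied by an injection
  into the natural numbers.
\<close>

locale ordered_vertices =
  fixes V :: "'v set" and r :: "'v \<Rightarrow> nat"
  assumes finite_V: "finite V" and inj_r: "inj_on r V"
begin

text \<open>
  Chains are functions on vertex sets, with values in any abelian group. The operators \<open>contract v\<close>
  and \<open>wedge v\<close> are contraction with and multiplication by the exterior generator \<open>e\<^sub>v\<close>.
  The sign depends only on \<open>S - {v}\<close>, so it is the same for \<open>S\<close> and \<open>insert v S\<close>.
  The Koszul differential multiplies the contraction with \<open>e\<^sub>v\<close> by \<open>\<mu> v\<close>: taking
  multiplication by the variables gives the Koszul complex of a module, and taking the identity gives
  simplicial chains.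
\<close>

definition ksign :: "'v \<Rightarrow> 'v set \<Rightarrow> 'a::ab_group_add \<Rightarrow> 'a" where
  "ksign v S x = (if even (card {u \<in> V. u \<in> S \<and> r u < r v}) then x else - x)"

definition contract :: "'v \<Rightarrow> ('v set \<Rightarrow> 'a::ab_group_add) \<Rightarrow> 'v set \<Rightarrow> 'a" where
  "contract v c S = (if v \<in> S then 0 else ksign v S (c (insert v S)))"

definition wedge :: "'v \<Rightarrow> ('v set \<Rightarrow> 'a::ab_group_add) \<Rightarrow> 'v set \<Rightarrow> 'a" where
  "wedge v c S = (if v \<in> S then ksign v S (c (S - {v})) else 0)"

definition koszul :: "('v \<Rightarrow> 'a::ab_group_add \<Rightarrow> 'a) \<Rightarrow> ('v set \<Rightarrow> 'a) \<Rightarrow> 'v set \<Rightarrow> 'a" where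
  "koszul \<mu> c S = (\<Sum>v\<in>V. \<mu> v (contract v c S))"

lemma ksign_zero [simp]: "ksign v S 0 = 0"
  and ksign_uminus: "ksign v S (- x) = - ksign v S x"
  and ksign_add: "ksign v S (x + y) = ksign v S x + ksign v S y"
  and ksign_diff: "ksign v S (x - y) = ksign v S x - ksign v S y"
  and ksign_ksign [simp]: "ksign v S (ksign v S x) = x"
  and ksign_eq_0_iff [simp]: "ksign v S x = 0 \<longleftrightarrow> x = 0"
  by (auto simp: ksign_def)

lemma ksign_swap: "ksign v S (ksign w T x) = ksign w T (ksign v S x)"
  by (auto simp: ksign_def)

lemma ksign_sum: "ksign v S (sum f A) = (\<Sum>a\<in>A. ksign v S (f a))"
  by (auto simp: ksign_def sum_negf)

lemma ksign_insert:
  assumes "w \<in> V" "w \<notin> S"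
  shows "ksign v (insert w S) x = (if r w < r v then - ksign v S x else ksign v S x)"
proof -
  have "{u \<in> V. u \<in> insert w S \<and> r u < r v} =
      (if r w < r v then insert w {u \<in> V. u \<in> S \<and> r u < r v} else {u \<in> V. u \<in> S \<and> r u < r v})"
    using assms by auto
  then show ?thesis
    using assms finite_V by (simp add: ksign_def)
qed

lemma contract_contract:
  assumes "v \<in> V" "w \<in> V"
  shows "contract v (contract w c) S = - contract w (contract v c) S"
proof (cases "v = w \<or> v \<in> S \<or> w \<in> S")
  case False
  then have "r v < r w \<or> r w < r v"
    using assms inj_r by (metis inj_onD linorder_neqE_nat)
  then show ?thesis
    using False assms
    by (auto simp: contract_def ksign_insert ksign_uminus insert_commute ksign_swap[of v])
qed (auto simp: contract_def)

lemma contract_contract_self [simp]: "contract v (contract v c) S = 0"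
  by (auto simp: contract_def)

lemma contract_wedge:
  assumes "v \<in> V" "w \<in> V" "v \<noteq> w"
  shows "contract w (wedge v c) S = - wedge v (contract w c) S"
proof (cases "v \<in> S \<and> w \<notin> S")
  case True
  then obtain T where T: "S = insert v T" "v \<notin> T"
    by (metis Set.set_insert)
  have "r v < r w \<or> r w < r v"
    using assms inj_r by (metis inj_onD linorder_neqE_nat)
  then show ?thesis
    using T True assms
    by (auto simp: contract_def wedge_def ksign_insert ksign_uminus insert_Diff_if ksign_swap[of v])
qed (use assms in \<open>auto simp: contract_def wedge_def\<close>)

lemma contract_wedge_self: "contract v (wedge v c) S = (if v \<in> S then 0 else c S)"
  and wedge_contract_self: "wedge v (contract v c) S = (if v \<in> S then c S else 0)"
proof -
  have "{u \<in> V. u \<in> insert v S \<and> r u < r v} = {u \<in> V. u \<in> S \<and> r u < r v}" for S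
    by auto
  then have "ksign v (insert v S) = (ksign v S :: 'a \<Rightarrow> 'a)" for S
    by (simp add: ksign_def fun_eq_iff)
  moreover have "{u \<in> V. u \<in> S - {v} \<and> r u < r v} = {u \<in> V. u \<in> S \<and> r u < r v}" for S
    by auto
  then have "ksign v (S - {v}) = (ksign v S :: 'a \<Rightarrow> 'a)" for S
    by (simp add: ksign_def fun_eq_iff)
  ultimately show "contract v (wedge v c) S = (if v \<in> S then 0 else c S)"
    and "wedge v (contract v c) S = (if v \<in> S then c S else 0)"
    by (auto simp: contract_def wedge_def insert_absorb)
qed

lemma contract_add: "contract v (\<lambda>S. c S + d S) S = contract v c S + contract v d S"
  and contract_diff: "contract v (\<lambda>S. c S - d S) S = contract v c S - contract v d S"
  and contract_zero [simp]: "contract v (\<lambda>S. 0) S = 0"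
  and wedge_zero [simp]: "wedge v (\<lambda>S. 0) S = 0"
  by (auto simp: contract_def wedge_def ksign_add ksign_diff)

end

text \<open>
  The condition on the diagonal is separate because antisymmetry does not imply it in characteristic
  two.
\<close>

lemma sum_alternating_eq_0:
  fixes T :: "'a \<Rightarrow> 'a \<Rightarrow> 'b::ab_group_add"
  assumes "finite A" "\<And>v w. v \<in> A \<Longrightarrow> w \<in> A \<Longrightarrow> T v w = - T w v" "\<And>v. v \<in> A \<Longrightarrow> T v v = 0"
  shows "(\<Sum>v\<in>A. \<Sum>w\<in>A. T v w) = 0"
  using assms
proof (induction A)
  case (insert a A)
  have "(\<Sum>w\<in>A. T w a) = - (\<Sum>w\<in>A. T a w)"
    unfolding sum_negf[symmetric] by (rule sum.cong) (simp, rule insert.prems(1), auto)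
  moreover have "(\<Sum>v\<in>A. \<Sum>w\<in>A. T v w) = 0"
    by (rule insert.IH) (rule insert.prems; simp)+
  ultimately show ?case
    using insert.hyps insert.prems(2)[of a] by (simp add: sum.distrib)
qed auto

locale koszul_complex = ordered_vertices V r
  for V :: "'v set" and r :: "'v \<Rightarrow> nat" +
  fixes \<mu> :: "'v \<Rightarrow> 'a::ab_group_add \<Rightarrow> 'a"
  assumes mult_add: "\<mu> v (x + y) = \<mu> v x + \<mu> v y"
    and mult_commute: "\<mu> v (\<mu> w x) = \<mu> w (\<mu> v x)"
begin

lemma mult_zero [simp]: "\<mu> v 0 = 0"
  using mult_add[of v 0 0] by simp

lemma mult_uminus: "\<mu> v (- x) = - \<mu> v x"
  using mult_add[of v x "- x"] by (simp add: eq_neg_iff_add_eq_0 add.commute)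

lemma mult_diff: "\<mu> v (x - y) = \<mu> v x - \<mu> v y"
  using mult_add[of v x "- y"] by (simp add: mult_uminus)

lemma mult_sum: "\<mu> v (sum f A) = (\<Sum>a\<in>A. \<mu> v (f a))"
  by (induction A rule: infinite_finite_induct) (auto simp: mult_add)

lemma mult_ksign: "\<mu> v (ksign w S x) = ksign w S (\<mu> v x)"
  by (simp add: ksign_def mult_uminus)

lemma koszul_add: "koszul \<mu> (\<lambda>S. c S + d S) S = koszul \<mu> c S + koszul \<mu> d S"
  by (simp add: koszul_def contract_add mult_add sum.distrib)

lemma koszul_diff: "koszul \<mu> (\<lambda>S. c S - d S) S = koszul \<mu> c S - koszul \<mu> d S"
  by (simp add: koszul_def contract_diff mult_diff sum_subtractf)

lemma koszul_zero [simp]: "koszul \<mu> (\<lambda>S. 0) S = 0"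
  by (simp add: koszul_def)

lemma contract_koszul:
  "contract v (koszul \<mu> c) S = (\<Sum>w\<in>V. \<mu> w (contract v (contract w c) S))"
  by (simp add: koszul_def contract_def[of v] ksign_sum mult_ksign)

lemma koszul_koszul: "koszul \<mu> (koszul \<mu> c) S = 0"
proof -
  have "koszul \<mu> (koszul \<mu> c) S =
      (\<Sum>v\<in>V. \<Sum>w\<in>V. \<mu> v (\<mu> w (contract v (contract w c) S)))"
    by (simp add: koszul_def[of \<mu> "koszul \<mu> c"] contract_koszul mult_sum)
  also have "\<dots> = 0"
  proof (rule sum_alternating_eq_0[OF finite_V])
    fix v w assume "v \<in> V" "w \<in> V"
    then show "\<mu> v (\<mu> w (contract v (contract w c) S)) = - \<mu> w (\<mu> v (contract w (contract v c) S))"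
      by (simp add: contract_contract[of v w] mult_uminus mult_commute[of v])
  qed simp
  finally show ?thesis .
qed

lemma koszul_contract:
  assumes "v \<in> V"
  shows "koszul \<mu> (contract v c) S = - contract v (koszul \<mu> c) S"
  unfolding contract_koszul koszul_def[of \<mu> "contract v c"] sum_negf[symmetric]
  by (rule sum.cong) (use assms in \<open>auto simp: contract_contract[of v] mult_uminus\<close>)

text \<open>
  The homotopy formula behind every contraction below: \<open>wedge v\<close> is a homotopy between
  multiplication by \<open>\<mu> v\<close> and zero.
\<close>

lemma koszul_wedge:
  assumes "v \<in> V"
  shows "koszul \<mu> (wedge v c) S = \<mu> v (c S) - wedge v (koszul \<mu> c) S"
proof -
  have w: "wedge v (koszul \<mu> c) S = (\<Sum>w\<in>V. \<mu> w (wedge v (contract w c) S))"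
    by (auto simp: koszul_def wedge_def[of v] ksign_sum mult_ksign)
  have "koszul \<mu> (wedge v c) S + wedge v (koszul \<mu> c) S =
      (\<Sum>w\<in>V. \<mu> w (contract w (wedge v c) S) + \<mu> w (wedge v (contract w c) S))"
    by (simp add: w koszul_def[of \<mu> "wedge v c"] sum.distrib)
  also have "\<dots> = (\<Sum>w\<in>V. if w = v then \<mu> v (c S) else 0)"
    by (rule sum.cong)
      (use assms in \<open>auto simp: contract_wedge mult_uminus contract_wedge_self wedge_contract_self\<close>)
  also have "\<dots> = \<mu> v (c S)"
    using assms finite_V by simp
  finally show ?thesis
    by (simp add: eq_diff_eq)
qed

end

section \<open>Complexes of vertex sets that miss an edge\<close>

text \<open>
  Homological positions are counted by the size of the sets, so a set of size \<open>p\<close> is a simplex of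
  dimension \<open>p - 1\<close> and the empty set takes part: the homology is reduced.
\<close>

definition chain_on :: "'v set set \<Rightarrow> nat \<Rightarrow> ('v set \<Rightarrow> 'a::zero) \<Rightarrow> bool" where
  "chain_on \<Delta> p c \<longleftrightarrow> (\<forall>S. c S \<noteq> 0 \<longrightarrow> S \<in> \<Delta> \<and> card S = p)"

text \<open>
  \<open>S\<close> is a vertex cover of the graph induced on \<open>W\<close> iff no edge lies in \<open>W - S\<close>. The sets that
  are not vertex covers form a simplicial complex, the Alexander dual of the independence complex.
\<close>

definition noncovers :: "'v set set \<Rightarrow> 'v set \<Rightarrow> 'v set set" where
  "noncovers E W = {S. S \<subseteq> W \<and> (\<exists>e\<in>E. e \<subseteq> W - S)}"

context ordered_vertices
begin

definition boundary :: "('v set \<Rightarrow> 'a::ab_group_add) \<Rightarrow> 'v set \<Rightarrow> 'a" where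
  "boundary = koszul (\<lambda>v x. x)"

definition acyclic_at :: "'a::ab_group_add itself \<Rightarrow> 'v set set \<Rightarrow> nat \<Rightarrow> bool" where
  "acyclic_at k \<Delta> p \<longleftrightarrow>
    (\<forall>c :: 'v set \<Rightarrow> 'a. chain_on \<Delta> p c \<longrightarrow> boundary c = (\<lambda>S. 0) \<longrightarrow>
      (\<exists>d. chain_on \<Delta> (p + 1) d \<and> boundary d = c))"

lemma koszul_complex_simplicial: "koszul_complex V r (\<lambda>v x :: 'a::ab_group_add. x)"
  unfolding koszul_complex_def koszul_complex_axioms_def
  using ordered_vertices_axioms by blast

lemmas simplicial_koszul_add = koszul_complex.koszul_add[OF koszul_complex_simplicial]
  and simplicial_koszul_diff = koszul_complex.koszul_diff[OF koszul_complex_simplicial]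
  and simplicial_koszul_zero = koszul_complex.koszul_zero[OF koszul_complex_simplicial]
  and simplicial_koszul_koszul = koszul_complex.koszul_koszul[OF koszul_complex_simplicial]
  and simplicial_koszul_contract = koszul_complex.koszul_contract[OF koszul_complex_simplicial]
  and simplicial_koszul_wedge = koszul_complex.koszul_wedge[OF koszul_complex_simplicial]

lemma acyclic_atD:
  assumes "acyclic_at TYPE('a::ab_group_add) \<Delta> p" "chain_on \<Delta> p c" "\<And>S. boundary c S = (0 :: 'a)"
  obtains d where "chain_on \<Delta> (p + 1) d" "boundary d = c"
proof -
  have "boundary c = (\<lambda>S. 0)"
    using assms(3) by auto
  with assms(1)[unfolded acyclic_at_def, rule_format, OF assms(2)]
  have "\<exists>d. chain_on \<Delta> (p + 1) d \<and> boundary d = c" .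
  then show ?thesis
    using that by (elim exE conjE)
qed

lemma chain_on_wedge:
  assumes "chain_on \<Delta> p c" "\<And>S. S \<in> \<Delta> \<Longrightarrow> v \<notin> S \<Longrightarrow> insert v S \<in> \<Delta>'" "\<And>S. S \<in> \<Delta> \<Longrightarrow> finite S"
  shows "chain_on \<Delta>' (p + 1) (wedge v c)"
  unfolding chain_on_def
proof (intro allI impI)
  fix S assume "wedge v c S \<noteq> 0"
  then have v: "v \<in> S" and c: "c (S - {v}) \<noteq> 0"
    by (auto simp: wedge_def split: if_splits)
  have S: "S = insert v (S - {v})"
    using v by auto
  from c have "S - {v} \<in> \<Delta>" "card (S - {v}) = p"
    using assms(1) by (auto simp: chain_on_def)
  then have "insert v (S - {v}) \<in> \<Delta>'" "card (insert v (S - {v})) = p + 1"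
    using assms(2)[of "S - {v}"] assms(3)[of "S - {v}"] card_insert_disjoint[of "S - {v}" v] by auto
  with S show "S \<in> \<Delta>' \<and> card S = p + 1"
    by simp
qed

lemma acyclic_at_empty: "acyclic_at TYPE('a::ab_group_add) {} p"
  unfolding acyclic_at_def
proof (intro allI impI exI conjI)
  fix c :: "'v set \<Rightarrow> 'a" assume "chain_on {} p c"
  then have "c = (\<lambda>S. 0)"
    by (auto simp: chain_on_def)
  then show "boundary (\<lambda>S. 0) = c"
    by (auto simp: boundary_def simplicial_koszul_zero)
qed (simp add: chain_on_def)

lemma acyclic_at_cone:
  assumes "v \<in> V" "\<And>S. S \<in> \<Delta> \<Longrightarrow> insert v S \<in> \<Delta>" "\<And>S. S \<in> \<Delta> \<Longrightarrow> finite S"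
  shows "acyclic_at TYPE('a::ab_group_add) \<Delta> p"
  unfolding acyclic_at_def
proof (intro allI impI exI conjI)
  fix c :: "'v set \<Rightarrow> 'a"
  assume c: "chain_on \<Delta> p c" "boundary c = (\<lambda>S. 0)"
  show "chain_on \<Delta> (p + 1) (wedge v c)"
    by (rule chain_on_wedge[OF c(1)]) (use assms in auto)
  show "boundary (wedge v c) = c"
    using c(2) simplicial_koszul_wedge[OF \<open>v \<in> V\<close>, of c] by (auto simp: boundary_def)
qed

lemma chain_on_contract:
  assumes "chain_on \<Delta> (p + 1) c" "\<And>S. insert v S \<in> \<Delta> \<Longrightarrow> v \<notin> S \<Longrightarrow> S \<in> \<Delta>'" "\<And>S. S \<in> \<Delta> \<Longrightarrow> finite S"
  shows "chain_on \<Delta>' p (contract v c)"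
  unfolding chain_on_def
proof (intro allI impI)
  fix S assume "contract v c S \<noteq> 0"
  then have v: "v \<notin> S" and c: "c (insert v S) \<noteq> 0"
    by (auto simp: contract_def split: if_splits)
  from c have "insert v S \<in> \<Delta>" "card (insert v S) = p + 1"
    using assms(1) by (auto simp: chain_on_def)
  moreover from this(1) assms(3) have "finite S"
    by (metis finite_insert)
  ultimately show "S \<in> \<Delta>' \<and> card S = p"
    using assms(2) v by auto
qed

lemma noncovers_finite: "W \<subseteq> V \<Longrightarrow> S \<in> noncovers E W \<Longrightarrow> finite S"
  using finite_V by (auto simp: noncovers_def intro: rev_finite_subset)

lemma boundary_add_boundary:
  "boundary (\<lambda>S. c S + boundary d S) S = (boundary c S :: 'a::ab_group_add)"
  unfolding boundary_def
  by (subst simplicial_koszul_add) (simp add: simplicial_koszul_koszul)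

text \<open>
  If the part of \<open>c\<close> at \<open>v\<close> is the boundary of a chain \<open>d\<close> in the link of \<open>v\<close>, then adding the
  boundary of the cone \<open>v d\<close> replaces that part by \<open>d\<close>, which does not involve \<open>v\<close>.
  The set \<open>\<Lambda>\<close> stands for any part of the link.
\<close>

lemma homologous_chain_avoiding_vertex:
  fixes c :: "'v set \<Rightarrow> 'a::ab_group_add"
  assumes "v \<in> V" and fin: "\<And>S. S \<in> \<Delta> \<Longrightarrow> finite S" "\<And>S. S \<in> \<Lambda> \<Longrightarrow> finite S"
    and c: "chain_on \<Delta> (p + 1) c"
    and lk: "\<And>S. S \<in> \<Lambda> \<Longrightarrow> v \<notin> S \<and> S \<in> \<Delta> \<and> insert v S \<in> \<Delta>"
    and d: "chain_on \<Lambda> (p + 1) d" "boundary d = contract v c"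
  defines "c' \<equiv> \<lambda>S. c S + boundary (wedge v d) S"
  shows "chain_on {S \<in> \<Delta>. v \<notin> S} (p + 1) c'" "chain_on \<Delta> (p + 2) (wedge v d)"
    and "c' S = (if v \<in> S then 0 else c S) + d S"
proof -
  have w: "boundary (wedge v d) S = d S - (if v \<in> S then c S else 0)" for S
    using simplicial_koszul_wedge[OF \<open>v \<in> V\<close>, of d S] d(2)
    by (simp add: boundary_def wedge_contract_self)
  then have c': "c' S = (if v \<in> S then 0 else c S) + d S" for S
    by (simp add: c'_def)
  then show "c' S = (if v \<in> S then 0 else c S) + d S" .
  show "chain_on {S \<in> \<Delta>. v \<notin> S} (p + 1) c'"
    unfolding chain_on_def c'
  proof (intro allI impI)
    fix S assume "(if v \<in> S then 0 else c S) + d S \<noteq> 0"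
    then have "(v \<notin> S \<and> c S \<noteq> 0) \<or> d S \<noteq> 0"
      by (auto split: if_splits)
    then show "S \<in> {S \<in> \<Delta>. v \<notin> S} \<and> card S = p + 1"
      using c d(1) lk unfolding chain_on_def by blast
  qed
  show "chain_on \<Delta> (p + 2) (wedge v d)"
    using chain_on_wedge[OF d(1), of v \<Delta>] lk fin(2) by simp
qed

text \<open>
  The combinatorial heart. It is a Mayer-Vietoris argument for the two ends of an edge, made explicit
  on chains: the cycle is moved off \<open>v\<close>, then off \<open>w\<close>, and then it is coned off from a third
  vertex, which exists because \<open>W\<close> has at least three elements.
\<close>

lemma acyclic_at_noncovers:
  assumes E: "\<And>e. e \<in> E \<Longrightarrow> card e = 2"
    and W: "W \<subseteq> V" "card W \<ge> 3"
    and IH1: "\<And>U. U \<subseteq> V \<Longrightarrow> card U + 1 = card W \<Longrightarrow> acyclic_at TYPE('a::ab_group_add) (noncovers E U) i"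
    and IH2: "\<And>U. U \<subseteq> V \<Longrightarrow> card U + 2 = card W \<Longrightarrow> acyclic_at TYPE('a) (noncovers E U) i"
  shows "acyclic_at TYPE('a) (noncovers E W) (i + 1)"
proof (cases "\<exists>e\<in>E. e \<subseteq> W")
  case False
  then have empty: "noncovers E W = {}"
    by (auto simp: noncovers_def)
  show ?thesis
    unfolding empty by (rule acyclic_at_empty)
next
  case True
  then obtain v w where e: "{v, w} \<in> E" "v \<noteq> w" "v \<in> W" "w \<in> W"
    using E by (metis card_2_iff insert_subset)
  have "finite W"
    using W finite_V by (auto intro: rev_finite_subset)
  let ?N = "noncovers E"
  have fin: "S \<in> ?N U \<Longrightarrow> U \<subseteq> W \<Longrightarrow> finite S" for S U
    using noncovers_finite W by blast
  have link: "S \<in> ?N (U - {x})" if S: "insert x S \<in> ?N U" "x \<notin> S" for x S U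
  proof -
    obtain e where "e \<in> E" "e \<subseteq> U - insert x S" "insert x S \<subseteq> U"
      using S(1) unfolding noncovers_def by blast
    with S(2) have "S \<subseteq> U - {x}" "e \<in> E" "e \<subseteq> U - {x} - S"
      by auto
    then show ?thesis
      unfolding noncovers_def by blast
  qed
  have unlink: "S \<in> ?N (U - {x}) \<Longrightarrow> x \<in> U \<Longrightarrow> x \<notin> S \<and> S \<in> ?N U \<and> insert x S \<in> ?N U" for x S U
  proof -
    assume "S \<in> ?N (U - {x})" "x \<in> U"
    moreover from this obtain e where "e \<in> E" "e \<subseteq> U - {x} - S" "S \<subseteq> U - {x}"
      unfolding noncovers_def by blast
    ultimately have "x \<notin> S" "S \<subseteq> U" "insert x S \<subseteq> U" "e \<in> E" "e \<subseteq> U - S" "e \<subseteq> U - insert x S"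
      by auto
    then show "x \<notin> S \<and> S \<in> ?N U \<and> insert x S \<in> ?N U"
      unfolding noncovers_def by blast
  qed
  have vV: "v \<in> V" and wV: "w \<in> V"
    using e W by auto
  show ?thesis
    unfolding acyclic_at_def
  proof (intro allI impI)
    fix c :: "'v set \<Rightarrow> 'a"
    assume c: "chain_on (?N W) (i + 1) c" "boundary c = (\<lambda>S. 0)"
    have card_Diff: "card (W - {v}) + 1 = card W" "card (W - {w}) + 1 = card W"
      "card (W - {w} - {v}) + 2 = card W"
      using e W(2) \<open>finite W\<close> by (auto simp: card_Diff_singleton)
    have acv: "acyclic_at TYPE('a) (?N (W - {v})) i"
      and acw: "acyclic_at TYPE('a) (?N (W - {w})) i"
      and acvw: "acyclic_at TYPE('a) (?N (W - {w} - {v})) i"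
      using W(1) by (auto intro!: IH1[OF _ card_Diff(1)] IH1[OF _ card_Diff(2)] IH2[OF _ card_Diff(3)])
    have bdry_contract: "boundary (contract x c) S = 0"
      if "\<And>S. boundary c S = 0" "x \<in> V" for x S and c :: "'v set \<Rightarrow> 'a"
    proof -
      have "koszul (\<lambda>v x. x) c = (\<lambda>S. 0)"
        using that(1) by (auto simp: boundary_def)
      then show ?thesis
        using simplicial_koszul_contract[OF that(2), of c S] by (simp add: boundary_def)
    qed
    \<comment> \<open>Move the cycle off v, using that the link of v is acyclic.\<close>
    have "chain_on (?N (W - {v})) i (contract v c)"
      by (rule chain_on_contract[OF c(1)]) (auto intro: link fin)
    then obtain d where d: "chain_on (?N (W - {v})) (i + 1) d" "boundary d = contract v c"
      using acyclic_atD[OF acv] bdry_contract[of c v] c(2) vV by metis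
    define c1 where "c1 = (\<lambda>S. c S + boundary (wedge v d) S)"
    have c1: "chain_on {S \<in> ?N W. v \<notin> S} (i + 1) c1" "chain_on (?N W) (i + 2) (wedge v d)"
      unfolding c1_def
      using homologous_chain_avoiding_vertex(1,2)[OF vV _ _ c(1) _ d] fin unlink[of _ W v] e by blast+
    have c1_cycle: "boundary c1 S = 0" for S
      unfolding c1_def boundary_add_boundary by (simp add: c(2))
    \<comment> \<open>The part at w is the boundary of a chain g in the link of w, but g may involve v again.\<close>
    have g0: "chain_on {S \<in> ?N (W - {w}). v \<notin> S} i (contract w c1)"
      by (rule chain_on_contract[OF c1(1)]) (auto intro: link fin)
    then have "chain_on (?N (W - {w})) i (contract w c1)"
      by (auto simp: chain_on_def)
    then obtain g where g: "chain_on (?N (W - {w})) (i + 1) g" "boundary g = contract w c1"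
      using acyclic_atD[OF acw] bdry_contract[of c1 w] c1_cycle wV by metis
    \<comment> \<open>The part of g at v is a cycle because v does not occur in c1; it is removed by the same step one level down.\<close>
    have "chain_on (?N (W - {w} - {v})) i (contract v g)"
      by (rule chain_on_contract[OF g(1)]) (auto intro: link fin)
    moreover have "boundary (contract v g) S = 0" for S
    proof -
      have "c1 (insert v S) = 0" for S
        using c1(1) unfolding chain_on_def by blast
      then have "contract v c1 = (\<lambda>S. 0)"
        by (simp add: contract_def fun_eq_iff)
      then have "contract v (contract w c1) S = 0"
        using contract_contract[OF vV wV, of c1 S] by simp
      then show ?thesis
        using simplicial_koszul_contract[OF vV, of g S] g(2) by (simp add: boundary_def)
    qed
    ultimately obtain k where k: "chain_on (?N (W - {w} - {v})) (i + 1) k" "boundary k = contract v g"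
      using acyclic_atD[OF acvw] by metis
    define g' where "g' = (\<lambda>S. g S + boundary (wedge v k) S)"
    have g': "chain_on {S \<in> ?N (W - {w}). v \<notin> S} (i + 1) g'"
      unfolding g'_def
      using homologous_chain_avoiding_vertex(1)[OF vV _ _ g(1) _ k] fin unlink[of _ "W - {w}" v] e by blast
    have bg': "boundary g' = contract w c1"
      unfolding g'_def fun_eq_iff boundary_add_boundary by (simp add: g(2))
    define c2 where "c2 = (\<lambda>S. c1 S + boundary (wedge w g') S)"
    have c2: "chain_on {S \<in> {S \<in> ?N W. v \<notin> S}. w \<notin> S} (i + 1) c2"
      "chain_on {S \<in> ?N W. v \<notin> S} (i + 2) (wedge w g')"
      unfolding c2_def
      using homologous_chain_avoiding_vertex(1,2)[OF wV _ _ c1(1) _ g' bg'] fin unlink[of _ W w] e by blast+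
    have c2_cycle: "boundary c2 S = 0" for S
      unfolding c2_def boundary_add_boundary by (simp add: c1_cycle)
    \<comment> \<open>All subsets of W that avoid v and w are faces, so a third vertex is an apex for c2.\<close>
    have "\<not> W \<subseteq> {v, w}"
      using W(2) card_mono[of "{v, w}" W] card_insert_le_m1[of 2 "{w}" v] by auto
    then obtain u where u: "u \<in> W" "u \<noteq> v" "u \<noteq> w"
      by auto
    then have uV: "u \<in> V"
      using W by auto
    have cone: "insert u S \<in> ?N W" if "S \<in> {S \<in> {S \<in> ?N W. v \<notin> S}. w \<notin> S}" for S
    proof -
      have "S \<subseteq> W" "v \<notin> S" "w \<notin> S"
        using that by (auto simp: noncovers_def)
      then have "insert u S \<subseteq> W" "{v, w} \<subseteq> W - insert u S"
        using u e by auto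
      then show ?thesis
        using e(1) unfolding noncovers_def by blast
    qed
    have "chain_on (?N W) (i + 1 + 1) (wedge u c2)"
      by (rule chain_on_wedge[OF c2(1) cone]) (auto intro: fin)
    moreover have "boundary (wedge u c2) S = c2 S" for S
    proof -
      have "koszul (\<lambda>v x. x) c2 = (\<lambda>S. 0)"
        using c2_cycle by (auto simp: boundary_def)
      then show ?thesis
        using simplicial_koszul_wedge[OF uV, of c2 S] by (simp add: boundary_def)
    qed
    ultimately have u2: "chain_on (?N W) (i + 2) (wedge u c2)" "boundary (wedge u c2) = c2"
      by auto
    let ?z = "\<lambda>S. wedge u c2 S - wedge w g' S - wedge v d S"
    have "boundary ?z S = c S" for S
    proof -
      have "boundary ?z S = boundary (wedge u c2) S - boundary (wedge w g') S - boundary (wedge v d) S"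
        by (simp only: boundary_def simplicial_koszul_diff)
      also have "\<dots> = c S"
        unfolding u2(2) by (simp add: c2_def c1_def)
      finally show ?thesis .
    qed
    moreover have "chain_on (?N W) (i + 2) ?z"
      unfolding chain_on_def
    proof (intro allI impI)
      fix S assume "?z S \<noteq> 0"
      then have "wedge u c2 S \<noteq> 0 \<or> wedge w g' S \<noteq> 0 \<or> wedge v d S \<noteq> 0"
        by auto
      then show "S \<in> ?N W \<and> card S = i + 2"
        using u2(1) c2(2) c1(2) unfolding chain_on_def by blast
    qed
    ultimately show "\<exists>d. chain_on (?N W) (i + 1 + 1) d \<and> boundary d = c"
      by (intro exI[of _ ?z]) auto
  qed
qed

end

section \<open>Koszul homology of graded modules\<close>

context ordered_vertices
begin

definition koszul_boundary :: "('v set \<Rightarrow> ('v, 'k::comm_ring_1) free_elem) \<Rightarrow> 'v set \<Rightarrow> ('v, 'k) free_elem" where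
  "koszul_boundary = koszul (\<lambda>v. scale (var v))"

text \<open>
  The number \<open>q\<close> is the degree of the values of the chain; its total degree is \<open>p + q\<close>, and the
  Koszul differential, which raises \<open>q\<close> and lowers \<open>p\<close> by one, preserves it.
\<close>

definition koszul_chain ::
  "('v, 'k::comm_ring_1) free_elem set \<Rightarrow> nat \<Rightarrow> int \<Rightarrow> ('v set \<Rightarrow> ('v, 'k) free_elem) \<Rightarrow> bool" where
  "koszul_chain M p q c \<longleftrightarrow> (\<forall>S. c S \<in> degree_piece M q) \<and> (\<forall>S. c S \<noteq> 0 \<longrightarrow> S \<subseteq> V \<and> card S = p)"

definition koszul_vanishes :: "('v, 'k::comm_ring_1) free_elem set \<Rightarrow> nat \<Rightarrow> int \<Rightarrow> bool" where
  "koszul_vanishes M p q \<longleftrightarrow> (\<forall>c. koszul_chain M p q c \<longrightarrow> koszul_boundary c = (\<lambda>S. 0) \<longrightarrow>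
     (\<exists>d. koszul_chain M (p + 1) (q - 1) d \<and> koszul_boundary d = c))"

lemma koszul_complex_scale: "koszul_complex V r (\<lambda>v. scale (var v :: ('v, 'k::comm_ring_1) mpoly))"
  unfolding koszul_complex_def koszul_complex_axioms_def
  using ordered_vertices_axioms by (auto simp: scale_add_right scale_scale mult.commute)

lemmas koszul_boundary_diff = koszul_complex.koszul_diff[OF koszul_complex_scale, folded koszul_boundary_def]
  and koszul_boundary_boundary = koszul_complex.koszul_koszul[OF koszul_complex_scale, folded koszul_boundary_def]

lemma koszul_chainD:
  assumes "koszul_chain M p q c"
  shows "c S \<in> degree_piece M q" "c S \<in> M" "c S \<noteq> 0 \<Longrightarrow> S \<subseteq> V" "c S \<noteq> 0 \<Longrightarrow> card S = p"
  using assms unfolding koszul_chain_def by (blast intro: degree_piece_subset)+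

lemma koszul_chainI:
  assumes "\<And>S. c S \<in> degree_piece M q" "\<And>S. c S \<noteq> 0 \<Longrightarrow> S \<subseteq> V \<and> card S = p"
  shows "koszul_chain M p q c"
  using assms unfolding koszul_chain_def by blast

lemma koszul_vanishesE:
  assumes "koszul_vanishes M p q" "koszul_chain M p q c" "\<And>S. koszul_boundary c S = 0"
  obtains d where "koszul_chain M (p + 1) (q - 1) d" "\<And>S. koszul_boundary d S = c S"
proof -
  have "koszul_boundary c = (\<lambda>S. 0)"
    using assms(3) by auto
  with assms(1)[unfolded koszul_vanishes_def, rule_format, OF assms(2)]
  have "\<exists>d. koszul_chain M (p + 1) (q - 1) d \<and> koszul_boundary d = c" .
  then show ?thesis
    using that by auto
qed

lemma koszul_vanishesI:
  assumes "\<And>c. koszul_chain M p q c \<Longrightarrow> (\<And>S. koszul_boundary c S = 0) \<Longrightarrow>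
    \<exists>d. koszul_chain M (p + 1) (q - 1) d \<and> (\<forall>S. koszul_boundary d S = c S)"
  shows "koszul_vanishes M p q"
  unfolding koszul_vanishes_def
proof (intro allI impI)
  fix c assume "koszul_chain M p q c" "koszul_boundary c = (\<lambda>S. 0)"
  with assms[of c] obtain d where "koszul_chain M (p + 1) (q - 1) d" "\<And>S. koszul_boundary d S = c S"
    by auto
  then show "\<exists>d. koszul_chain M (p + 1) (q - 1) d \<and> koszul_boundary d = c"
    by blast
qed

lemma degree_piece_ksign:
  "graded_submodule V M \<Longrightarrow> x \<in> degree_piece M q \<Longrightarrow> ksign v S x \<in> degree_piece M q"
  by (auto simp: ksign_def intro: degree_piece_uminus)

lemma koszul_chain_bdry:
  assumes M: "graded_submodule V M" and c: "koszul_chain M (p + 1) q c"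
  shows "koszul_chain M p (q + 1) (koszul_boundary c)"
proof (rule koszul_chainI)
  fix S
  have "contract v c S \<in> degree_piece M q" for v
    using koszul_chainD(1)[OF c] degree_piece_zero[OF M] degree_piece_ksign[OF M]
    by (auto simp: contract_def)
  then show "koszul_boundary c S \<in> degree_piece M (q + 1)"
    unfolding koszul_boundary_def koszul_def
    by (intro degree_piece_sum[OF M] degree_piece_scale_var[OF M])
  assume "koszul_boundary c S \<noteq> 0"
  then obtain v where v: "v \<in> V" "scale (var v) (contract v c S) \<noteq> 0"
    unfolding koszul_boundary_def koszul_def by (meson sum.neutral)
  then have "contract v c S \<noteq> 0"
    by auto
  then have "v \<notin> S" "c (insert v S) \<noteq> 0"
    by (auto simp: contract_def split: if_splits)
  then have "v \<notin> S" "insert v S \<subseteq> V" "card (insert v S) = p + 1"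
    using koszul_chainD(3,4)[OF c] by auto
  then show "S \<subseteq> V \<and> card S = p"
    using finite_subset[OF _ finite_V, of S] by auto
qed

lemma koszul_chain_diff:
  assumes M: "graded_submodule V M" and c: "koszul_chain M p q c" "koszul_chain M p q d"
  shows "koszul_chain M p q (\<lambda>S. c S - d S)"
proof (rule koszul_chainI)
  fix S
  show "c S - d S \<in> degree_piece M q"
    using koszul_chainD(1)[OF c(1)] koszul_chainD(1)[OF c(2)] by (rule degree_piece_diff[OF M])
  assume "c S - d S \<noteq> 0"
  then have "c S \<noteq> 0 \<or> d S \<noteq> 0"
    by auto
  then show "S \<subseteq> V \<and> card S = p"
    using koszul_chainD(3,4)[OF c(1)] koszul_chainD(3,4)[OF c(2)] by blast
qed

lemma koszul_chain_mono: "koszul_chain M p q c \<Longrightarrow> M \<subseteq> N \<Longrightarrow> koszul_chain N p q c"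
  unfolding koszul_chain_def using degree_piece_mono by blast

lemma koszul_chain_map:
  assumes "graded_submodule V M" "graded_map V M f" "f ` M \<subseteq> N" "koszul_chain M p q c"
  shows "koszul_chain N p q (\<lambda>S. f (c S))"
proof (rule koszul_chainI)
  fix S
  show "f (c S) \<in> degree_piece N q"
    using degree_piece_graded_map[OF assms(1,2,3)] koszul_chainD(1)[OF assms(4)] .
  assume "f (c S) \<noteq> 0"
  then have "c S \<noteq> 0"
    using graded_map_zero[OF assms(1,2)] by metis
  then show "S \<subseteq> V \<and> card S = p"
    using koszul_chainD(3,4)[OF assms(4)] by blast
qed

lemma koszul_chain_lift:
  assumes "graded_submodule V M" "graded_map V M f" "f ` M = N" "koszul_chain N p q c"
  obtains c' where "koszul_chain M p q c'" "\<And>S. f (c' S) = c S"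
proof -
  have "\<exists>x. x \<in> degree_piece M q \<and> f x = c S \<and> (c S = 0 \<longrightarrow> x = 0)" for S
    using degree_piece_lift[OF assms(1-3) koszul_chainD(1)[OF assms(4)]] by metis
  then obtain c' where c': "\<And>S. c' S \<in> degree_piece M q \<and> f (c' S) = c S \<and> (c S = 0 \<longrightarrow> c' S = 0)"
    by metis
  then have "koszul_chain M p q c'"
    using koszul_chainD(3,4)[OF assms(4)] by (intro koszul_chainI) blast+
  with c' show ?thesis
    using that by blast
qed

lemma koszul_boundary_map:
  assumes M: "graded_submodule V M" and f: "graded_map V M f" and chain: "koszul_chain M p q c"
  shows "koszul_boundary (\<lambda>S. f (c S)) S = f (koszul_boundary c S)"
proof -
  note c = koszul_chainD(2)[OF chain]
  have cM: "contract v c S \<in> M" for v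
    using c graded_submodule_zero[OF M] graded_submodule_uminus[OF M]
    by (auto simp: contract_def ksign_def)
  have fc: "contract v (\<lambda>S. f (c S)) S = f (contract v c S)" for v
    using c graded_map_zero[OF M f] graded_map_uminus[OF M f]
    by (auto simp: contract_def ksign_def)
  have "f (koszul_boundary c S) = (\<Sum>v\<in>V. f (scale (var v) (contract v c S)))"
    unfolding koszul_boundary_def koszul_def
    by (rule graded_map_sum[OF M f]) (rule graded_submodule_scale[OF M poly_ring_var cM])
  also have "\<dots> = (\<Sum>v\<in>V. scale (var v) (contract v (\<lambda>S. f (c S)) S))"
    by (rule sum.cong) (simp_all add: fc graded_map_scale[OF f poly_ring_var cM])
  finally show ?thesis
    by (simp add: koszul_boundary_def koszul_def)
qed

section \<open>The multigraded strands of a Koszul complex\<close>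

definition squarefree_monomial :: "'v set \<Rightarrow> 'v \<Rightarrow>\<^sub>0 nat" where
  "squarefree_monomial S = (\<Sum>v\<in>S. Poly_Mapping.single v 1)"

lemma lookup_squarefree_monomial: "finite S \<Longrightarrow> Poly_Mapping.lookup (squarefree_monomial S) v = (if v \<in> S then 1 else 0)"
  by (simp add: squarefree_monomial_def lookup_sum lookup_single when_def)

lemma mdeg_squarefree_monomial: "finite S \<Longrightarrow> mdeg (squarefree_monomial S) = card S"
  unfolding squarefree_monomial_def by (induction S rule: finite_induct) (simp_all add: mdeg_add)

lemma keys_squarefree_monomial: "finite S \<Longrightarrow> Poly_Mapping.keys (squarefree_monomial S) = S"
  by (auto simp: in_keys_iff lookup_squarefree_monomial split: if_splits)

lemma finite_subset_keys: "S \<subseteq> Poly_Mapping.keys m \<Longrightarrow> finite S"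
  by (rule finite_subset) auto

lemma diff_squarefree_monomial_add:
  assumes "S \<subseteq> Poly_Mapping.keys m"
  shows "(m - squarefree_monomial S) + squarefree_monomial S = m"
proof -
  have "1 \<le> Poly_Mapping.lookup m v" if "v \<in> S" for v
    using that assms by (metis One_nat_def Suc_leI in_keys_iff neq0_conv subsetD)
  then show ?thesis
    using finite_subset_keys[OF assms]
    by (intro poly_mapping_eqI) (auto simp: lookup_add lookup_minus lookup_squarefree_monomial)
qed

lemma mdeg_diff_squarefree_monomial:
  assumes "S \<subseteq> Poly_Mapping.keys m"
  shows "mdeg m = mdeg (m - squarefree_monomial S) + card S"
  using arg_cong[OF diff_squarefree_monomial_add[OF assms], of mdeg] finite_subset_keys[OF assms]
  by (simp add: mdeg_add mdeg_squarefree_monomial)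

lemma diff_squarefree_monomial_insert:
  assumes "S \<subseteq> Poly_Mapping.keys m" "v \<notin> S"
  shows "m - squarefree_monomial S - Poly_Mapping.single v 1 = m - squarefree_monomial (insert v S)"
  using finite_subset_keys[OF assms(1)] assms
  by (intro poly_mapping_eqI) (auto simp: lookup_minus lookup_squarefree_monomial lookup_single when_def)

text \<open>
  The coefficients of a chain that have a fixed multidegree: the value at \<open>S\<close> is the coefficient of
  \<open>m\<close> divided by the product of \<open>S\<close>. Multiplication by a variable becomes the identity on such
  coefficients, so the Koszul differential becomes the simplicial boundary.
\<close>

definition strand ::
  "nat \<times> nat \<Rightarrow> ('v \<Rightarrow>\<^sub>0 nat) \<Rightarrow> ('v set \<Rightarrow> ('v, 'k::comm_ring_1) free_elem) \<Rightarrow> 'v set \<Rightarrow> 'k" where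
  "strand e m c S = (if S \<subseteq> Poly_Mapping.keys m then fcoeff (c S) e (m - squarefree_monomial S) else 0)"

lemma strand_koszul_boundary: "strand e m (koszul_boundary c) = boundary (strand e m c)"
proof
  fix S
  show "strand e m (koszul_boundary c) S = boundary (strand e m c) S"
  proof (cases "S \<subseteq> Poly_Mapping.keys m")
    case True
    have "fcoeff (scale (var v) (contract v c S)) e (m - squarefree_monomial S) = contract v (strand e m c) S" for v
    proof (cases "v \<in> S")
      case False
      have k: "v \<in> Poly_Mapping.keys (m - squarefree_monomial S) \<longleftrightarrow> v \<in> Poly_Mapping.keys m"
        using False finite_subset_keys[OF True] by (simp add: in_keys_iff lookup_minus lookup_squarefree_monomial)
      have "fcoeff (ksign v S x) e n = ksign v S (fcoeff x e n)" for x :: "('v, 'a) free_elem" and n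
        by (simp add: ksign_def fcoeff_uminus)
      then show ?thesis
        using False True
        by (simp add: fcoeff_scale_var k contract_def strand_def diff_squarefree_monomial_insert[simplified])
    qed (simp add: contract_def)
    then show ?thesis
      unfolding strand_def[of e m "koszul_boundary c"] unfolding boundary_def koszul_boundary_def koszul_def
      using True by (simp add: fcoeff_sum)
  next
    case False
    then have "contract v (strand e m c) S = 0" for v
      by (simp add: contract_def strand_def)
    then show ?thesis
      using False by (simp add: strand_def[of e m "koszul_boundary c"] boundary_def koszul_def)
  qed
qed

lemma strand_eqI:
  assumes "\<And>S. c S \<noteq> 0 \<Longrightarrow> S \<subseteq> V" "\<And>S. d S \<noteq> 0 \<Longrightarrow> S \<subseteq> V" "\<And>e m. strand e m c = strand e m d"
  shows "c S = d S"
proof (cases "S \<subseteq> V")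
  case True
  then have fin: "finite S"
    using finite_V by (rule finite_subset)
  show ?thesis
  proof (rule free_elem_eqI)
    fix e m
    have "S \<subseteq> Poly_Mapping.keys (m + squarefree_monomial S)" "m + squarefree_monomial S - squarefree_monomial S = m"
      using fin by (auto simp: keys_add_nat keys_squarefree_monomial)
    then show "fcoeff (c S) e m = fcoeff (d S) e m"
      using fun_cong[OF assms(3)[of e "m + squarefree_monomial S"], of S] by (simp add: strand_def)
  qed
qed (use assms(1,2) in metis)

text \<open>
  The vertex sets that can carry a nonzero coefficient in the strand at \<open>(e, m)\<close>. When \<open>A\<close> is the
  set of monomials of an ideal, this is the upper Koszul simplicial complex of the ideal at \<open>m\<close>.
\<close>

definition upper_koszul :: "((nat \<times> nat) \<times> ('v \<Rightarrow>\<^sub>0 nat)) set \<Rightarrow> nat \<times> nat \<Rightarrow> ('v \<Rightarrow>\<^sub>0 nat) \<Rightarrow> 'v set set" where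
  "upper_koszul A e m = {S. S \<subseteq> V \<and> S \<subseteq> Poly_Mapping.keys m \<and> (e, m - squarefree_monomial S) \<in> A}"

lemma chain_on_strand:
  assumes "koszul_chain (monomial_module A) p q c"
  shows "chain_on (upper_koszul A e m) p (strand e m c)"
    and "int (mdeg m + fst e) \<noteq> int p + q \<Longrightarrow> strand e m c S = 0"
proof -
  have *: "S \<in> upper_koszul A e m \<and> card S = p \<and> int (mdeg m + fst e) = int p + q"
    if "strand e m c S \<noteq> 0" for S
  proof -
    have S: "S \<subseteq> Poly_Mapping.keys m" "fcoeff (c S) e (m - squarefree_monomial S) \<noteq> 0" "c S \<noteq> 0"
      using that by (auto simp: strand_def split: if_splits)
    then show ?thesis
      using koszul_chainD[OF assms, of S] mdeg_diff_squarefree_monomial[OF S(1)]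
        degree_pieceD[of "c S" _ q e "m - squarefree_monomial S"] monomial_moduleD[of "c S" A e "m - squarefree_monomial S"]
      by (auto simp: upper_koszul_def)
  qed
  from * show "chain_on (upper_koszul A e m) p (strand e m c)"
    unfolding chain_on_def by blast
  from * show "int (mdeg m + fst e) \<noteq> int p + q \<Longrightarrow> strand e m c S = 0"
    by blast
qed

text \<open>
  Chains that bound the individual strands are assembled to a chain of module elements. Only
  finitely many monomials have the relevant degree, so each value has finite support.
\<close>

lemma koszul_boundary_of_strands:
  fixes c :: "'v set \<Rightarrow> ('v, 'k::comm_ring_1) free_elem"
  assumes fin: "\<And>q. finite {(e, m) \<in> A. int (mdeg m + fst e) = q}"
    and c: "koszul_chain (monomial_module A) p q c"
    and M: "graded_submodule V (monomial_module A :: ('v, 'k) free_elem set)"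
    and ex: "\<And>e m. int (mdeg m + fst e) = int p + q \<Longrightarrow>
      \<exists>d. chain_on (upper_koszul A e m) (p + 1) d \<and> boundary d = strand e m c"
  shows "\<exists>d. koszul_chain (monomial_module A) (p + 1) (q - 1) d \<and> (\<forall>S. koszul_boundary d S = c S)"
proof -
  let ?good = "\<lambda>e m. int (mdeg m + fst e) = int p + q"
  have "\<exists>d. chain_on (upper_koszul A e m) (p + 1) d \<and> boundary d = strand e m c \<and> (\<not> ?good e m \<longrightarrow> d = (\<lambda>S. 0))" for e m
  proof (cases "?good e m")
    case False
    then have "strand e m c = (\<lambda>S. 0)"
      using chain_on_strand(2)[OF c] by blast
    then show ?thesis
      using False by (intro exI[of _ "\<lambda>S. 0"])
        (auto simp: chain_on_def boundary_def simplicial_koszul_zero)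
  qed (use ex in blast)
  then obtain D where D: "\<And>e m. chain_on (upper_koszul A e m) (p + 1) (D e m)"
    "\<And>e m. boundary (D e m) = strand e m c" "\<And>e m. \<not> ?good e m \<Longrightarrow> D e m = (\<lambda>S. 0)"
    by metis
  \<comment> \<open>The monomials that can occur in the values of the assembled chain.\<close>
  define B where "B = {(e, m) \<in> A. int (mdeg m + fst e) = q - 1}"
  define d where "d S = (if S \<subseteq> V \<and> card S = p + 1
    then \<Sum>(e, m)\<in>B. Poly_Mapping.single e (Poly_Mapping.single m (D e (m + squarefree_monomial S) S)) else 0)" for S
  have B: "finite B"
    unfolding B_def by (rule fin)
  have fd: "fcoeff (d S) e m = (if S \<subseteq> V \<and> card S = p + 1 \<and> (e, m) \<in> B then D e (m + squarefree_monomial S) S else 0)" for S e m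
  proof -
    have "(\<Sum>x\<in>B. fcoeff (case x of (e, m) \<Rightarrow> Poly_Mapping.single e (Poly_Mapping.single m (D e (m + squarefree_monomial S) S))) e m)
      = (\<Sum>x\<in>B. if x = (e, m) then D e (m + squarefree_monomial S) S else 0)"
      by (rule sum.cong) (auto simp: fcoeff_single split: if_splits)
    then show ?thesis
      using B by (simp add: d_def fcoeff_sum)
  qed
  have d: "koszul_chain (monomial_module A) (p + 1) (q - 1) d"
  proof (rule koszul_chainI)
    fix S
    show "d S \<in> degree_piece (monomial_module A) (q - 1)"
      by (intro degree_pieceI monomial_moduleI) (auto simp: fd B_def split: if_splits)
    show "d S \<noteq> 0 \<Longrightarrow> S \<subseteq> V \<and> card S = p + 1"
      by (simp add: d_def split: if_splits)
  qed
  have sd: "strand e m d = D e m" for e m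
  proof
    fix S
    show "strand e m d S = D e m S"
    proof (cases "D e m S = 0")
      case True
      then show ?thesis
        by (simp add: strand_def fd diff_squarefree_monomial_add)
    next
      case False
      then have S: "S \<in> upper_koszul A e m" "card S = p + 1"
        using D(1) unfolding chain_on_def by blast+
      then have S': "S \<subseteq> V" "S \<subseteq> Poly_Mapping.keys m" "(e, m - squarefree_monomial S) \<in> A"
        by (auto simp: upper_koszul_def)
      have "?good e m"
        using D(3) False by metis
      then have "(e, m - squarefree_monomial S) \<in> B"
        using S' S(2) mdeg_diff_squarefree_monomial[OF S'(2)] by (simp add: B_def)
      then show ?thesis
        using S S' by (simp add: strand_def fd diff_squarefree_monomial_add)
    qed
  qed
  have "koszul_boundary d S = c S" for S
  proof (rule strand_eqI)
    show "koszul_boundary d S \<noteq> 0 \<Longrightarrow> S \<subseteq> V" for S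
      using koszul_chainD(3)[OF koszul_chain_bdry[OF M d]] .
    show "c S \<noteq> 0 \<Longrightarrow> S \<subseteq> V" for S
      using koszul_chainD(3)[OF c] .
    show "strand e m (koszul_boundary d) = strand e m c" for e m
      by (simp add: strand_koszul_boundary sd D(2))
  qed
  with d show ?thesis
    by blast
qed

text \<open>
  In the direction from Koszul homology to strands, a simplicial cycle in multidegree \<open>m\<close> is
  realised as a Koszul cycle whose only nonzero strand it is.
\<close>

lemma koszul_vanishes_monomial_module:
  fixes A
  defines "M \<equiv> monomial_module A :: ('v, 'k::comm_ring_1) free_elem set"
  assumes fin: "\<And>q. finite {(e, m) \<in> A. int (mdeg m + fst e) = q}"
    and M: "graded_submodule V M"
  shows "koszul_vanishes M p q \<longleftrightarrow>
    (\<forall>e m. int (mdeg m + fst e) = int p + q \<longrightarrow> acyclic_at TYPE('k) (upper_koszul A e m) p)"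
proof
  assume van: "koszul_vanishes M p q"
  show "\<forall>e m. int (mdeg m + fst e) = int p + q \<longrightarrow> acyclic_at TYPE('k) (upper_koszul A e m) p"
    unfolding acyclic_at_def
  proof (intro allI impI)
    fix e :: "nat \<times> nat" and m and c :: "'v set \<Rightarrow> 'k"
    assume deg: "int (mdeg m + fst e) = int p + q"
      and c: "chain_on (upper_koszul A e m) p c" "boundary c = (\<lambda>S. 0)"
    define C where "C S = Poly_Mapping.single e (Poly_Mapping.single (m - squarefree_monomial S) (c S))" for S
    have c_supp: "S \<subseteq> V \<and> S \<subseteq> Poly_Mapping.keys m \<and> (e, m - squarefree_monomial S) \<in> A \<and> card S = p" if "c S \<noteq> 0" for S
      using c(1) that by (auto simp: chain_on_def upper_koszul_def)
    have chain: "koszul_chain M p q C"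
    proof (rule koszul_chainI)
      fix S
      show "C S \<in> degree_piece M q"
        unfolding M_def
      proof (intro degree_pieceI monomial_moduleI)
        fix e' m' assume "fcoeff (C S) e' m' \<noteq> 0"
        then have *: "e' = e" "m' = m - squarefree_monomial S" "c S \<noteq> 0"
          by (auto simp: C_def fcoeff_single split: if_splits)
        then show "(e', m') \<in> A"
          using c_supp by simp
        show "int (mdeg m' + fst e') = q"
          using * c_supp[OF *(3)] mdeg_diff_squarefree_monomial[of S m] deg by simp
      qed
      show "C S \<noteq> 0 \<Longrightarrow> S \<subseteq> V \<and> card S = p"
        using c_supp by (force simp: C_def)
    qed
    have strand_C: "strand e' m' C = (if e' = e \<and> m' = m then c else (\<lambda>S. 0))" for e' m'
    proof
      fix S
      have "m' = m" if "m' - squarefree_monomial S = m - squarefree_monomial S" "S \<subseteq> Poly_Mapping.keys m'" "c S \<noteq> 0"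
        using that c_supp[of S] diff_squarefree_monomial_add[of S m] diff_squarefree_monomial_add[of S m'] by metis
      then show "strand e' m' C S = (if e' = e \<and> m' = m then c else (\<lambda>S. 0)) S"
        using c_supp[of S] by (auto simp: strand_def C_def fcoeff_single)
    qed
    have "koszul_boundary C S = 0" for S
    proof (rule strand_eqI[of _ "\<lambda>S. 0"])
      show "S \<subseteq> V" if "koszul_boundary C S \<noteq> 0" for S
      proof -
        obtain v where "scale (var v) (contract v C S) \<noteq> 0"
          using \<open>koszul_boundary C S \<noteq> 0\<close> unfolding koszul_boundary_def koszul_def by (meson sum.neutral)
        then have "contract v C S \<noteq> 0"
          by auto
        then have "C (insert v S) \<noteq> 0"
          by (auto simp: contract_def split: if_splits)
        then show ?thesis
          using koszul_chainD(3)[OF chain] by blast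
      qed
      show "strand e' m' (koszul_boundary C) = strand e' m' (\<lambda>S. 0)" for e' m'
        using c(2) by (auto simp: strand_koszul_boundary strand_C strand_def boundary_def simplicial_koszul_zero)
    qed simp
    then obtain d where d: "koszul_chain M (p + 1) (q - 1) d" "\<And>S. koszul_boundary d S = C S"
      using koszul_vanishesE[OF van chain] by metis
    have "koszul_boundary d = C"
      using d(2) by auto
    then have "boundary (strand e m d) = c"
      using strand_C[of e m] by (simp add: strand_koszul_boundary[symmetric])
    then show "\<exists>d. chain_on (upper_koszul A e m) (p + 1) d \<and> boundary d = c"
      using chain_on_strand(1)[OF d(1)[unfolded M_def]] by blast
  qed
next
  assume acyc: "\<forall>e m. int (mdeg m + fst e) = int p + q \<longrightarrow> acyclic_at TYPE('k) (upper_koszul A e m) p"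
  show "koszul_vanishes M p q"
  proof (rule koszul_vanishesI)
    fix c :: "'v set \<Rightarrow> ('v, 'k) free_elem"
    assume c: "koszul_chain M p q c" "\<And>S. koszul_boundary c S = 0"
    show "\<exists>d. koszul_chain M (p + 1) (q - 1) d \<and> (\<forall>S. koszul_boundary d S = c S)"
      unfolding M_def
    proof (rule koszul_boundary_of_strands[OF fin])
      show "koszul_chain (monomial_module A) p q c" "graded_submodule V (monomial_module A :: ('v, 'k) free_elem set)"
        using c(1) M by (simp_all add: M_def)
      fix e :: "nat \<times> nat" and m :: "'v \<Rightarrow>\<^sub>0 nat" assume "int (mdeg m + fst e) = int p + q"
      then have ac: "acyclic_at TYPE('k) (upper_koszul A e m) p"
        using acyc by blast
      have "boundary (strand e m c) S = 0" for S
        using c(2) by (simp add: strand_koszul_boundary[symmetric] strand_def)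
      then show "\<exists>d. chain_on (upper_koszul A e m) (p + 1) d \<and> boundary d = strand e m c"
        using acyclic_atD[OF ac chain_on_strand(1)[OF c(1)[unfolded M_def]]] by metis
    qed
  qed
qed

text \<open>
  The Koszul complex of a free module is exact except for the constants in homological degree \<open>0\<close>:
  the strand at a monomial \<open>m \<noteq> 0\<close> is a full simplex on the variables dividing \<open>m\<close>, hence a cone,
  and the strand at \<open>0\<close> sees nothing but the constant coefficients of \<open>c {}\<close>.
  For \<open>p > 0\<close> the value \<open>c {}\<close> is \<open>0\<close>.
\<close>

lemma koszul_cycle_graded_free:
  fixes c :: "'v set \<Rightarrow> ('v, 'k::comm_ring_1) free_elem"
  assumes c: "koszul_chain (graded_free V b) p q c" "\<And>S. koszul_boundary c S = 0"
    and const: "\<And>e. fcoeff (c {}) e 0 = 0"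
  shows "\<exists>d. koszul_chain (graded_free V b) (p + 1) (q - 1) d \<and> (\<forall>S. koszul_boundary d S = c S)"
  unfolding graded_free_eq_monomial_module
proof (rule koszul_boundary_of_strands[OF finite_free_monomials[OF finite_V]])
  show chain: "koszul_chain (monomial_module (free_monomials V b)) p q c"
    using c(1) by (simp add: graded_free_eq_monomial_module)
  show "graded_submodule V (monomial_module (free_monomials V b) :: ('v, 'k) free_elem set)"
    using graded_submodule_graded_free by (simp add: graded_free_eq_monomial_module)
  fix e :: "nat \<times> nat" and m :: "'v \<Rightarrow>\<^sub>0 nat"
  let ?\<Delta> = "upper_koszul (free_monomials V b) e m"
  note strand_chain = chain_on_strand(1)[OF chain, of e m]
  have cycle: "boundary (strand e m c) S = 0" for S
    using c(2) by (simp add: strand_koszul_boundary[symmetric] strand_def)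
  show "\<exists>d. chain_on ?\<Delta> (p + 1) d \<and> boundary d = strand e m c"
  proof (cases "Poly_Mapping.keys m \<subseteq> V \<and> m \<noteq> 0")
    case True
    then obtain v where v: "v \<in> Poly_Mapping.keys m" "v \<in> V"
      by (metis all_not_in_conv in_keys_iff lookup_zero poly_mapping_eqI subsetD)
    have "Poly_Mapping.keys (m - squarefree_monomial S) \<subseteq> V" for S
      using True by (auto simp: in_keys_iff lookup_minus dest: subsetD)
    then have "insert v S \<in> ?\<Delta>" if "S \<in> ?\<Delta>" for S
      using that v by (auto simp: upper_koszul_def free_monomials_def)
    moreover have "finite S" if "S \<in> ?\<Delta>" for S
      using that finite_subset[OF _ finite_V] by (auto simp: upper_koszul_def)
    ultimately have "acyclic_at TYPE('k) ?\<Delta> p"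
      using v(2) by (intro acyclic_at_cone)
    then show ?thesis
      using acyclic_atD[OF _ strand_chain cycle] by metis
  next
    case False
    have "strand e m c S = 0" for S
    proof (rule ccontr)
      assume nz: "strand e m c S \<noteq> 0"
      then have S: "S \<subseteq> V" "S \<subseteq> Poly_Mapping.keys m" "Poly_Mapping.keys (m - squarefree_monomial S) \<subseteq> V"
        using strand_chain by (auto simp: chain_on_def upper_koszul_def free_monomials_def)
      have "Poly_Mapping.keys m = Poly_Mapping.keys (m - squarefree_monomial S) \<union> S"
        using arg_cong[OF diff_squarefree_monomial_add[OF S(2)], of Poly_Mapping.keys] finite_subset_keys[OF S(2)]
        by (simp add: keys_add_nat keys_squarefree_monomial)
      with S False have "m = 0" "S = {}"
        by auto
      then show False
        using nz const[of e] by (simp add: strand_def squarefree_monomial_def)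
    qed
    then have "strand e m c = (\<lambda>S. 0)"
      by blast
    then show ?thesis
      by (intro exI[of _ "\<lambda>S. 0"]) (auto simp: chain_on_def boundary_def simplicial_koszul_zero)
  qed
qed

section \<open>Dimension shifting along a resolution\<close>

context
  fixes b :: "nat \<Rightarrow> nat" and f :: "('v, 'k::comm_ring_1) free_elem \<Rightarrow> ('v, 'k) free_elem" and Z K
  assumes f: "graded_map V (graded_free V b) f" and Z: "f ` graded_free V b = Z"
    and K: "K = {x \<in> graded_free V b. f x = 0}"
    and minimal: "\<And>x e. x \<in> K \<Longrightarrow> fcoeff x e 0 = 0"
begin

private abbreviation "F \<equiv> graded_free V b :: ('v, 'k) free_elem set"

private lemma F: "graded_submodule V F"
  by (rule graded_submodule_graded_free)

private lemma subK: "K \<subseteq> F"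
  using K by auto

private lemma koszul_chain_kernel:
  assumes "koszul_chain F p q c" "\<And>S. f (c S) = 0"
  shows "koszul_chain K p q c"
  using assms by (auto simp: koszul_chain_def K degree_piece_def)

text \<open>
  This is the connecting isomorphism of \<open>0 \<rightarrow> K \<rightarrow> F \<rightarrow> Z \<rightarrow> 0\<close>, in terms of vanishing.
  Minimality is used for \<open>p = 0\<close>: elements of \<open>K\<close> have no constant coefficients, so they are
  boundaries in the Koszul complex of \<open>F\<close>.
\<close>

lemma koszul_vanishes_shift:
  "koszul_vanishes Z (p + 1) q \<longleftrightarrow> koszul_vanishes K p (q + 1)"
proof
  assume van: "koszul_vanishes K p (q + 1)"
  show "koszul_vanishes Z (p + 1) q"
  proof (rule koszul_vanishesI)
    fix c assume c: "koszul_chain Z (p + 1) q c" "\<And>S. koszul_boundary c S = 0"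
    obtain c' where c': "koszul_chain F (p + 1) q c'" "\<And>S. f (c' S) = c S"
      using koszul_chain_lift[OF F f Z c(1)] by blast
    have "f (koszul_boundary c' S) = 0" for S
      using koszul_boundary_map[OF F f c'(1), of S] c(2)[of S] c'(2) by simp
    then have "koszul_chain K p (q + 1) (koszul_boundary c')"
      using koszul_chain_kernel koszul_chain_bdry[OF F c'(1)] by blast
    then obtain k where k: "koszul_chain K (p + 1) q k" "\<And>S. koszul_boundary k S = koszul_boundary c' S"
      using koszul_vanishesE[OF van _ koszul_boundary_boundary] by auto
    define z where "z S = c' S - k S" for S
    have z: "koszul_chain F (p + 1) q z"
      unfolding z_def by (rule koszul_chain_diff[OF F c'(1) koszul_chain_mono[OF k(1) subK]])
    have "koszul_boundary z S = 0" for S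
      unfolding z_def koszul_boundary_diff by (simp add: k(2))
    moreover have "z {} = 0"
      using koszul_chainD(4)[OF z, of "{}"] by auto
    ultimately obtain d where d: "koszul_chain F (p + 1 + 1) (q - 1) d" "\<And>S. koszul_boundary d S = z S"
      using koszul_cycle_graded_free[OF z] by auto
    have "koszul_boundary (\<lambda>S. f (d S)) S = c S" for S
    proof -
      have "k S \<in> K"
        using koszul_chainD(2)[OF k(1)] .
      then have "f (z S) = c S"
        using graded_map_diff[OF F f, of "c' S" "k S"] koszul_chainD(2)[OF c'(1), of S] c'(2) K
        by (auto simp: z_def)
      then show ?thesis
        using koszul_boundary_map[OF F f d(1), of S] d(2) by simp
    qed
    moreover have "koszul_chain Z (p + 1 + 1) (q - 1) (\<lambda>S. f (d S))"
      using koszul_chain_map[OF F f _ d(1)] Z by simp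
    ultimately show "\<exists>d. koszul_chain Z (p + 1 + 1) (q - 1) d \<and> (\<forall>S. koszul_boundary d S = c S)"
      by blast
  qed
next
  assume van: "koszul_vanishes Z (p + 1) q"
  show "koszul_vanishes K p (q + 1)"
  proof (rule koszul_vanishesI)
    fix k assume k: "koszul_chain K p (q + 1) k" "\<And>S. koszul_boundary k S = 0"
    have "fcoeff (k {}) e 0 = 0" for e
      using minimal koszul_chainD(2)[OF k(1)] by blast
    then obtain c where c: "koszul_chain F (p + 1) q c" "\<And>S. koszul_boundary c S = k S"
      using koszul_cycle_graded_free[OF koszul_chain_mono[OF k(1) subK] k(2)] by auto
    have "koszul_boundary (\<lambda>S. f (c S)) S = 0" for S
      using koszul_boundary_map[OF F f c(1), of S] c(2) koszul_chainD(2)[OF k(1), of S] K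
      by auto
    moreover have "koszul_chain Z (p + 1) q (\<lambda>S. f (c S))"
      using koszul_chain_map[OF F f _ c(1)] Z by simp
    ultimately obtain z where z: "koszul_chain Z (p + 1 + 1) (q - 1) z" "\<And>S. koszul_boundary z S = f (c S)"
      using koszul_vanishesE[OF van] by metis
    obtain z' where z': "koszul_chain F (p + 1 + 1) (q - 1) z'" "\<And>S. f (z' S) = z S"
      using koszul_chain_lift[OF F f Z z(1)] by blast
    have bz': "koszul_chain F (p + 1) q (koszul_boundary z')"
      using koszul_chain_bdry[OF F z'(1)] by simp
    define d where "d S = c S - koszul_boundary z' S" for S
    have "f (d S) = 0" for S
    proof -
      have "f (koszul_boundary z' S) = f (c S)"
        using koszul_boundary_map[OF F f z'(1), of S] z(2)[of S] z'(2) by simp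
      then show ?thesis
        unfolding d_def
        using graded_map_diff[OF F f, of "c S" "koszul_boundary z' S"]
          koszul_chainD(2)[OF c(1), of S] koszul_chainD(2)[OF bz', of S] by simp
    qed
    then have "koszul_chain K (p + 1) q d"
      using koszul_chain_kernel koszul_chain_diff[OF F c(1) bz'] by (simp add: d_def[abs_def])
    moreover have "koszul_boundary d S = k S" for S
      unfolding d_def koszul_boundary_diff koszul_boundary_boundary by (simp add: c(2))
    ultimately show "\<exists>d. koszul_chain K (p + 1) (q + 1 - 1) d \<and> (\<forall>S. koszul_boundary d S = k S)"
      by auto
  qed
qed

text \<open>
  Koszul homology in homological degree \<open>0\<close> is \<open>Z / \<mm> Z\<close>. If the free module has no generator of
  degree \<open>n\<close>, lifts of degree \<open>n\<close> have no constant coefficients, so they lie in \<open>\<mm> F\<close>. Conversely,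
  if the image of a basis element of degree \<open>n\<close> lay in \<open>\<mm> Z\<close>, the kernel would contain an element
  with constant coefficient \<open>1\<close>.
\<close>

lemma koszul_vanishes_0_iff_no_generators:
  "koszul_vanishes Z 0 (int n) \<longleftrightarrow> b n = 0"
proof
  assume b: "b n = 0"
  show "koszul_vanishes Z 0 (int n)"
  proof (rule koszul_vanishesI)
    fix c assume c: "koszul_chain Z 0 (int n) c" "\<And>S. koszul_boundary c S = 0"
    obtain c' where c': "koszul_chain F 0 (int n) c'" "\<And>S. f (c' S) = c S"
      using koszul_chain_lift[OF F f Z c(1)] by blast
    have supp: "S = {}" if "c' S \<noteq> 0" for S
      using koszul_chainD(3,4)[OF c'(1) that] finite_subset[OF _ finite_V] by auto
    have "koszul_boundary c' S = 0" for S
    proof -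
      have "contract v c' S = 0" for v
        using supp[of "insert v S"] by (auto simp: contract_def)
      then show ?thesis
        by (simp add: koszul_boundary_def koszul_def)
    qed
    moreover have "fcoeff (c' {}) e 0 = 0" for e
    proof (rule ccontr)
      assume nz: "fcoeff (c' {}) e 0 \<noteq> 0"
      then have "fst e = n"
        using degree_pieceD[OF koszul_chainD(1)[OF c'(1)] nz] by simp
      moreover have "snd e < b (fst e)"
        using nz koszul_chainD(2)[OF c'(1), of "{}"] unfolding graded_free_iff by blast
      ultimately show False
        using b by simp
    qed
    ultimately obtain d where d: "koszul_chain F (0 + 1) (int n - 1) d" "\<And>S. koszul_boundary d S = c' S"
      using koszul_cycle_graded_free[OF c'(1)] by auto
    have "koszul_boundary (\<lambda>S. f (d S)) S = c S" for S
      using koszul_boundary_map[OF F f d(1), of S] d(2) c'(2) by simp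
    moreover have "koszul_chain Z (0 + 1) (int n - 1) (\<lambda>S. f (d S))"
      using koszul_chain_map[OF F f _ d(1)] Z by simp
    ultimately show "\<exists>d. koszul_chain Z (0 + 1) (int n - 1) d \<and> (\<forall>S. koszul_boundary d S = c S)"
      by blast
  qed
next
  assume van: "koszul_vanishes Z 0 (int n)"
  show "b n = 0"
  proof (rule ccontr)
    assume b: "b n \<noteq> 0"
    define x :: "('v, 'k) free_elem" where
      "x = Poly_Mapping.single (n, 0) (Poly_Mapping.single 0 1)"
    have fcoeff_x: "fcoeff x e m = (if e = (n, 0) \<and> m = 0 then 1 else 0)" for e m
      unfolding x_def by (rule fcoeff_single)
    have x: "x \<in> degree_piece F (int n)"
      using b unfolding degree_piece_of_nat
      by (auto simp: graded_free_iff fcoeff_x intro!: free_homogeneousI split: if_splits)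
    define c where "c S = (if S = {} then f x else 0)" for S :: "'v set"
    have fx: "f x \<in> degree_piece Z (int n)"
      using degree_piece_graded_map[OF F f _ x] Z by simp
    have "0 \<in> Z"
      using Z graded_map_zero[OF F f] graded_submodule_zero[OF F] by force
    then have c: "koszul_chain Z 0 (int n) c"
      using fx by (intro koszul_chainI) (auto simp: c_def degree_piece_def split: if_splits)
    have "contract v c S = 0" for v S
      by (auto simp: contract_def c_def)
    then have "koszul_boundary c S = 0" for S
      by (simp add: koszul_boundary_def koszul_def)
    then obtain d where d: "koszul_chain Z (0 + 1) (int n - 1) d" "\<And>S. koszul_boundary d S = c S"
      using koszul_vanishesE[OF van c] by metis
    obtain d' where d': "koszul_chain F (0 + 1) (int n - 1) d'" "\<And>S. f (d' S) = d S"
      using koszul_chain_lift[OF F f Z d(1)] by blast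
    let ?y = "koszul_boundary d' {}"
    have "f ?y = f x"
      using koszul_boundary_map[OF F f d'(1), of "{}"] d(2)[of "{}"] d'(2)
      by (simp add: c_def)
    moreover have y: "?y \<in> F"
      using koszul_chainD(2)[OF koszul_chain_bdry[OF F d'(1)]] .
    ultimately have "x - ?y \<in> K"
      using graded_map_diff[OF F f _ y, of x] x graded_submodule_diff[OF F _ y, of x]
      by (auto simp: K dest: degree_piece_subset)
    then have "fcoeff (x - ?y) (n, 0) 0 = 0"
      by (rule minimal)
    moreover have "fcoeff ?y (n, 0) 0 = 0"
      by (simp add: koszul_boundary_def koszul_def fcoeff_sum fcoeff_scale_var)
    ultimately show False
      by (simp add: fcoeff_diff fcoeff_x)
  qed
qed

end

end

context ordered_vertices
begin

text \<open>
  The homological degree is traded against syzygies until it is \<open>0\<close>: the shift is iterated along the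
  syzygy modules \<open>Z k\<close>, which is why the induction is over all \<open>k\<close>.
\<close>

lemma koszul_vanishes_iff_no_generators:
  assumes res: "minimally_resolves V M b f" and n: "int n = q + int p"
  shows "koszul_vanishes M p q \<longleftrightarrow> b p n = 0"
proof -
  define Z where "Z k = f k ` graded_free V (b k)" for k
  have res': "graded_map V (graded_free V (b k)) (f k)"
    "Z (Suc k) = {x \<in> graded_free V (b k). f k x = 0}"
    "x \<in> Z (Suc k) \<Longrightarrow> fcoeff x e 0 = 0" for k x e
    using res unfolding minimally_resolves_def Z_def by (blast, blast, blast)
  have "koszul_vanishes (Z k) p q \<longleftrightarrow> b (k + p) n = 0" if "int n = q + int p" for k
    using that
  proof (induction p arbitrary: k q)
    case 0
    have "koszul_vanishes (Z k) 0 (int n) \<longleftrightarrow> b k n = 0"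
      by (rule koszul_vanishes_0_iff_no_generators[OF res'(1) Z_def[symmetric] res'(2)]) (rule res'(3))
    with 0 show ?case
      by simp
  next
    case (Suc p)
    have "koszul_vanishes (Z k) (p + 1) q \<longleftrightarrow> koszul_vanishes (Z (Suc k)) p (q + 1)"
      by (rule koszul_vanishes_shift[OF res'(1) Z_def[symmetric] res'(2)]) (rule res'(3))
    then show ?case
      using Suc.IH[of "q + 1" "Suc k"] Suc.prems by simp
  qed
  moreover have "Z 0 = M"
    using res by (simp add: minimally_resolves_def Z_def)
  ultimately show ?thesis
    using n by (metis add_0)
qed

end

section \<open>Resolutions of ideals\<close>

text \<open>
  An ideal is treated as a submodule of a free module with one generator, placed in degree \<open>0\<close>.
\<close>

definition embed :: "('v, 'k::zero) mpoly \<Rightarrow> ('v, 'k) free_elem" where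
  "embed p = Poly_Mapping.single (0, 0) p"

lemma fcoeff_embed: "fcoeff (embed p) e m = (if e = (0, 0) then Poly_Mapping.lookup p m else 0)"
  by (auto simp: fcoeff_def embed_def lookup_single when_def)

lemma embed_add: "embed (p + q) = embed p + embed q"
  by (rule free_elem_eqI) (simp add: fcoeff_embed fcoeff_add lookup_add)

lemma embed_mult: "embed (p * q) = scale p (embed q)"
  by (rule poly_mapping_eqI) (simp add: embed_def lookup_scale lookup_single when_def)

lemma embed_eq_0_iff: "embed p = 0 \<longleftrightarrow> p = 0"
  by (simp add: embed_def) (metis lookup_single_eq lookup_zero single_zero)

lemma free_homogeneous_embed: "free_homogeneous n (embed p) \<longleftrightarrow> homogeneous n p"
  by (auto simp: free_homogeneous_iff homogeneous_def fcoeff_embed in_keys_iff)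

lemma lookup_embed: "Poly_Mapping.lookup (embed p) (0, 0) = p"
  by (simp add: embed_def)

lemma minimal_graded_free_resolution_imp_minimally_resolves:
  fixes I :: "('v, 'k::field) mpoly set"
  assumes "minimal_graded_free_resolution V I F"
  shows "minimally_resolves V (embed ` I) (copies F)
    (\<lambda>i. case i of 0 \<Rightarrow> \<lambda>x. embed (augmentation F x) | Suc k \<Rightarrow> differential F k)"
proof -
  interpret minimal_graded_free_resolution V I F
    by (rule assms)
  let ?f = "\<lambda>i. case i of 0 \<Rightarrow> \<lambda>x. embed (augmentation F x) | Suc k \<Rightarrow> differential F k"
  have graded: "graded_map V (graded_free V (copies F i)) (?f i)" for i
  proof (cases i)
    case 0
    then show ?thesis
      using augmentation_linear augmentation_graded
      by (auto simp: graded_map_def linear_over_def free_homogeneous_embed embed_add embed_mult)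
  next
    case (Suc k)
    then show ?thesis
      using differential_linear[of k] differential_graded[of _ k] by (auto simp: graded_map_def)
  qed
  have image: "?f 0 ` graded_free V (copies F 0) = embed ` I"
    using augmentation_onto by (simp add: image_image[symmetric])
  have exact: "?f (Suc i) ` graded_free V (copies F (Suc i)) =
      {x \<in> graded_free V (copies F i). ?f i x = 0}" for i
    using exact_0 exact_Suc by (cases i) (simp_all add: embed_eq_0_iff)
  have min: "fcoeff x e 0 = 0" if "x \<in> graded_free V (copies F i)" "?f i x = 0" for x i e
  proof -
    have "x \<in> differential F i ` graded_free V (copies F (Suc i))"
      using that exact[of i] by auto
    then show ?thesis
      using minimal[of _ i e] by (auto simp: fcoeff_def)
  qed
  show ?thesis
    unfolding minimally_resolves_def
    by (intro conjI allI ballI impI) (rule graded image exact min; assumption)+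
qed

lemma minimally_resolves_imp_minimal_graded_free_resolution:
  fixes I :: "('v, 'k::field) mpoly set"
  assumes res: "minimally_resolves V (embed ` I) b f"
  shows "minimal_graded_free_resolution V I
    \<lparr>copies = b, differential = \<lambda>i. f (Suc i), augmentation = \<lambda>x. Poly_Mapping.lookup (f 0 x) (0, 0)\<rparr>"
proof -
  let ?F = "\<lambda>i. graded_free V (b i)"
  have f: "graded_map V (?F i) (f i)" for i
    using res by (simp add: minimally_resolves_def)
  have im0: "f 0 ` ?F 0 = embed ` I"
    using res by (simp add: minimally_resolves_def)
  have exact: "f (Suc i) ` ?F (Suc i) = {x \<in> ?F i. f i x = 0}" for i
    using res by (simp add: minimally_resolves_def)
  have minimal: "fcoeff x e 0 = 0" if "x \<in> ?F i" "f i x = 0" for x i e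
    using res that unfolding minimally_resolves_def by blast
  have f0: "f 0 x = embed (Poly_Mapping.lookup (f 0 x) (0, 0))" if "x \<in> ?F 0" for x
    using that im0 lookup_embed by (smt (verit, ccfv_threshold) imageE image_eqI)
  show ?thesis
  proof (unfold_locales, simp_all)
    fix i
    show "f (Suc i) ` ?F (Suc i) \<subseteq> ?F i"
      using exact by blast
    show "linear_over (poly_ring V) (?F (Suc i)) scale scale (f (Suc i))"
      using f by (simp add: graded_map_def)
    show "linear_over (poly_ring V) (?F 0) scale (*) (\<lambda>x. Poly_Mapping.lookup (f 0 x) (0, 0))"
      using f[of 0] by (simp add: graded_map_def linear_over_def lookup_add lookup_scale)
    show "(\<lambda>x. Poly_Mapping.lookup (f 0 x) (0, 0)) ` ?F 0 = I"
    proof -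
      have "(\<lambda>x. Poly_Mapping.lookup (f 0 x) (0, 0)) ` ?F 0 = (\<lambda>y. Poly_Mapping.lookup y (0, 0)) ` (f 0 ` ?F 0)"
        by (simp add: image_image)
      also have "\<dots> = I"
        unfolding im0 by (simp add: image_image lookup_embed)
      finally show ?thesis .
    qed
    have "f 0 x = 0 \<longleftrightarrow> Poly_Mapping.lookup (f 0 x) (0, 0) = 0" if "x \<in> ?F 0" for x
      using f0[OF that] embed_eq_0_iff by metis
    then show "{x \<in> ?F 0. Poly_Mapping.lookup (f 0 x) (0, 0) = 0} = f (Suc 0) ` ?F (Suc 0)"
      using exact[of 0] by auto
    show "{x \<in> ?F (Suc i). f (Suc i) x = 0} = f (Suc (Suc i)) ` ?F (Suc (Suc i))"
      using exact by simp
  next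
    fix x :: "('v, 'k) free_elem" and i n assume "x \<in> ?F (Suc i)" "free_homogeneous n x"
    then show "free_homogeneous n (f (Suc i) x)"
      using graded_map_homogeneous[OF f] by blast
  next
    fix x :: "('v, 'k) free_elem" and n assume "x \<in> ?F 0" "free_homogeneous n x"
    then show "homogeneous n (Poly_Mapping.lookup (f 0 x) (0, 0))"
      using graded_map_homogeneous[OF f[of 0]] f0 free_homogeneous_embed by metis
  next
    fix x :: "('v, 'k) free_elem" and i and e :: "nat \<times> nat" assume "x \<in> ?F (Suc i)"
    then have "f (Suc i) x \<in> ?F i" "f i (f (Suc i) x) = 0"
      using exact[of i] by blast+
    then show "Poly_Mapping.lookup (Poly_Mapping.lookup (f (Suc i) x) e) 0 = 0"
      using minimal[of "f (Suc i) x" i e] by (simp add: fcoeff_def)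
  qed
qed

section \<open>Edge ideals\<close>

definition edge_monomials :: "'v set \<Rightarrow> 'v set set \<Rightarrow> ('v \<Rightarrow>\<^sub>0 nat) set" where
  "edge_monomials V E = {m. Poly_Mapping.keys m \<subseteq> V \<and> (\<exists>e\<in>E. e \<subseteq> Poly_Mapping.keys m)}"

lemma generated_ideal_add:
  assumes "p \<in> generated_ideal V S" "q \<in> generated_ideal V S"
  shows "p + q \<in> generated_ideal V S"
proof -
  obtain c T d U where T: "finite T" "T \<subseteq> S" "\<forall>s\<in>T. c s \<in> poly_ring V" "p = (\<Sum>s\<in>T. c s * s)"
    and U: "finite U" "U \<subseteq> S" "\<forall>s\<in>U. d s \<in> poly_ring V" "q = (\<Sum>s\<in>U. d s * s)"
    using assms by (auto simp: generated_ideal_def)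
  define c' d' where "c' s = (if s \<in> T then c s else 0)" and "d' s = (if s \<in> U then d s else 0)" for s
  have "p = (\<Sum>s\<in>T \<union> U. c' s * s)"
    unfolding T(4) using T(1) U(1) by (intro sum.mono_neutral_cong_left) (auto simp: c'_def)
  moreover have "q = (\<Sum>s\<in>T \<union> U. d' s * s)"
    unfolding U(4) using T(1) U(1) by (intro sum.mono_neutral_cong_left) (auto simp: d'_def)
  ultimately have "p + q = (\<Sum>s\<in>T \<union> U. (c' s + d' s) * s)"
    by (simp add: sum.distrib distrib_right)
  moreover have "\<forall>s\<in>T \<union> U. c' s + d' s \<in> poly_ring V"
    using T(3) U(3) by (auto simp: c'_def d'_def intro!: poly_ring_add poly_ring_zero)
  ultimately show ?thesis
    using T(1,2) U(1,2) unfolding generated_ideal_def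
    by (intro CollectI exI[of _ "\<lambda>s. c' s + d' s"] exI[of _ "T \<union> U"]) auto
qed

lemma generated_ideal_mult:
  "s \<in> S \<Longrightarrow> a \<in> poly_ring V \<Longrightarrow> a * s \<in> generated_ideal V S"
  unfolding generated_ideal_def by (intro CollectI exI[of _ "\<lambda>_. a"] exI[of _ "{s}"]) auto

lemma generated_ideal_sum:
  "(\<And>a. a \<in> A \<Longrightarrow> f a \<in> generated_ideal V S) \<Longrightarrow> sum f A \<in> generated_ideal V S"
proof (induction A rule: infinite_finite_induct)
  case empty
  show ?case
    unfolding generated_ideal_def by (intro CollectI exI[of _ "\<lambda>_. 0"] exI[of _ "{}"]) auto
next
  case (infinite A)
  then show ?case
    unfolding generated_ideal_def by (intro CollectI exI[of _ "\<lambda>_. 0"] exI[of _ "{}"]) auto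
qed (auto intro: generated_ideal_add)

lemma edge_ideal_eq:
  assumes G: "finite_simple_graph V E"
  shows "edge_ideal V E = {p :: ('v, 'k::field) mpoly. Poly_Mapping.keys p \<subseteq> edge_monomials V E}"
proof (intro equalityI subsetI CollectI)
  fix p :: "('v, 'k) mpoly" and m
  let ?S = "{var u * var v | u v. {u, v} \<in> E} :: ('v, 'k) mpoly set"
  assume p: "p \<in> edge_ideal V E" and m: "m \<in> Poly_Mapping.keys p"
  from p obtain c T where T: "finite T" "T \<subseteq> ?S" "\<forall>s\<in>T. c s \<in> poly_ring V" "p = (\<Sum>s\<in>T. c s * s)"
    by (auto simp: edge_ideal_def generated_ideal_def)
  have "Poly_Mapping.lookup p m \<noteq> 0"
    using m by (simp add: in_keys_iff)
  then obtain s where s: "s \<in> T" "Poly_Mapping.lookup (c s * s) m \<noteq> 0"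
    unfolding T(4) lookup_sum by (meson sum.neutral)
  then obtain u v where uv: "{u, v} \<in> E" "s = var u * var v"
    using T(2) by blast
  have vs: "s = Poly_Mapping.single (Poly_Mapping.single u 1 + Poly_Mapping.single v 1) 1"
    by (simp add: uv var_def mult_single)
  obtain a where a: "a \<in> Poly_Mapping.keys (c s)" "m = a + (Poly_Mapping.single u 1 + Poly_Mapping.single v 1)"
    using s(2) keys_mult[of "c s" s] by (auto simp: in_keys_iff[symmetric] vs)
  have "Poly_Mapping.keys a \<subseteq> V" "{u, v} \<subseteq> V"
    using T(3) s(1) a(1) G uv(1) by (auto simp: poly_ring_def finite_simple_graph_def)
  then show "m \<in> edge_monomials V E"
    unfolding edge_monomials_def using uv(1) a(2) by (auto simp: keys_add_nat intro!: bexI[of _ "{u, v}"])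
next
  fix p :: "('v, 'k) mpoly"
  let ?S = "{var u * var v | u v. {u, v} \<in> E} :: ('v, 'k) mpoly set"
  assume p: "p \<in> {p. Poly_Mapping.keys p \<subseteq> edge_monomials V E}"
  have "Poly_Mapping.single m a \<in> generated_ideal V ?S" if m: "m \<in> Poly_Mapping.keys p" for m a
  proof -
    obtain e where e: "e \<in> E" "e \<subseteq> Poly_Mapping.keys m" and mV: "Poly_Mapping.keys m \<subseteq> V"
      using p m by (auto simp: edge_monomials_def)
    then obtain u v where uv: "e = {u, v}" "u \<noteq> v"
      using G by (metis card_2_iff finite_simple_graph_def)
    define m' where "m' = m - Poly_Mapping.single u 1 - Poly_Mapping.single v 1"
    have "v \<in> Poly_Mapping.keys (m - Poly_Mapping.single u 1)"
      using e uv by (auto simp: in_keys_iff lookup_minus lookup_single)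
    then have m': "m = Poly_Mapping.single u 1 + (Poly_Mapping.single v 1 + m')"
      using mdeg_diff_single[of u m] mdeg_diff_single[of v "m - Poly_Mapping.single u 1"] e(2) uv(1)
      unfolding m'_def by simp
    then have "Poly_Mapping.single m a = Poly_Mapping.single m' a * (var u * var v)"
      by (simp add: var_def mult_single algebra_simps)
    moreover have "Poly_Mapping.keys m' \<subseteq> V"
      using mV by (auto simp: m'_def in_keys_iff lookup_minus)
    moreover have "var u * var v \<in> ?S"
      using e uv by blast
    ultimately show ?thesis
      using generated_ideal_mult[of "var u * var v" ?S "Poly_Mapping.single m' a" V]
        poly_ring_single[of m' V a] by (simp only:)
  qed
  then have "(\<Sum>m\<in>Poly_Mapping.keys p. Poly_Mapping.single m (Poly_Mapping.lookup p m)) \<in> generated_ideal V ?S"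
    by (rule generated_ideal_sum)
  then show "p \<in> edge_ideal V E"
    unfolding edge_ideal_def by (simp add: sum_monomials[symmetric])
qed

lemma monomial_module_mono: "A \<subseteq> B \<Longrightarrow> monomial_module A \<subseteq> monomial_module B"
  unfolding monomial_module_def by blast

lemma embed_edge_ideal:
  assumes "finite_simple_graph V E"
  shows "embed ` edge_ideal V E =
    (monomial_module ({(0, 0)} \<times> edge_monomials V E) :: ('v, 'k::field) free_elem set)"
proof (intro equalityI subsetI)
  fix x :: "('v, 'k) free_elem" assume "x \<in> embed ` edge_ideal V E"
  then show "x \<in> monomial_module ({(0, 0)} \<times> edge_monomials V E)"
    unfolding edge_ideal_eq[OF assms]
    by (auto intro!: monomial_moduleI simp: fcoeff_embed in_keys_iff split: if_splits)
next
  fix x :: "('v, 'k) free_elem" assume x: "x \<in> monomial_module ({(0, 0)} \<times> edge_monomials V E)"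
  have "x = embed (Poly_Mapping.lookup x (0, 0))"
  proof (rule free_elem_eqI)
    fix e m
    show "fcoeff x e m = fcoeff (embed (Poly_Mapping.lookup x (0, 0))) e m"
      using monomial_moduleD[OF x, of e m] by (auto simp: fcoeff_embed) (simp add: fcoeff_def)
  qed
  moreover have "Poly_Mapping.lookup x (0, 0) \<in> edge_ideal V E"
    unfolding edge_ideal_eq[OF assms]
    using monomial_moduleD[OF x, of "(0, 0)"] by (auto simp: in_keys_lookup_iff)
  ultimately show "x \<in> embed ` edge_ideal V E"
    by (rule image_eqI)
qed

context ordered_vertices
begin

lemma upper_koszul_edge_ideal_squarefree:
  assumes "W \<subseteq> V"
  shows "upper_koszul ({(0, 0)} \<times> edge_monomials V E) (0, 0) (squarefree_monomial W) = noncovers E W"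
proof -
  have fin: "finite W"
    using assms finite_V by (rule finite_subset)
  have "S \<in> upper_koszul ({(0, 0)} \<times> edge_monomials V E) (0, 0) (squarefree_monomial W) \<longleftrightarrow> S \<in> noncovers E W" for S
  proof (cases "S \<subseteq> W")
    case True
    then have keys: "Poly_Mapping.keys (squarefree_monomial W - squarefree_monomial S) = W - S"
      using finite_subset[OF True fin] fin
      by (auto simp: in_keys_iff lookup_minus lookup_squarefree_monomial split: if_splits)
    have "S \<subseteq> V" "W - S \<subseteq> V"
      using True assms by auto
    with True show ?thesis
      using fin by (simp add: upper_koszul_def noncovers_def edge_monomials_def keys keys_squarefree_monomial)
  qed (use fin in \<open>simp add: upper_koszul_def noncovers_def keys_squarefree_monomial\<close>)
  then show ?thesis
    by blast
qed

text \<open>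
  If \<open>v\<close> divides \<open>m\<close> twice, removing one \<open>v\<close> does not change which variables divide the
  monomial, and membership in an edge ideal depends only on these. So \<open>v\<close> is an apex.
\<close>

lemma acyclic_at_edge_ideal_not_squarefree:
  assumes v: "Poly_Mapping.lookup m v \<ge> 2"
  shows "acyclic_at TYPE('a::ab_group_add) (upper_koszul ({(0, 0)} \<times> edge_monomials V E) e m) p"
proof -
  let ?\<Delta> = "upper_koszul ({(0, 0)} \<times> edge_monomials V E) e m"
  have fin: "finite S" if "S \<in> ?\<Delta>" for S
    using that finite_subset[OF _ finite_V] by (auto simp: upper_koszul_def)
  have keys: "Poly_Mapping.keys (m - squarefree_monomial (insert v S)) = Poly_Mapping.keys (m - squarefree_monomial S)"
    if "finite S" for S
    using that v by (auto simp: in_keys_iff lookup_minus lookup_squarefree_monomial split: if_splits)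
  have v_keys: "v \<in> Poly_Mapping.keys m"
    using v by (simp add: in_keys_iff)
  show ?thesis
  proof (cases "v \<in> V")
    case True
    show ?thesis
    proof (rule acyclic_at_cone[OF True _ fin])
      fix S assume S: "S \<in> ?\<Delta>"
      then show "insert v S \<in> ?\<Delta>"
        using True v_keys keys[OF fin[OF S]] by (auto simp: upper_koszul_def edge_monomials_def)
    qed
  next
    case False
    have "?\<Delta> = {}"
    proof (rule equals0I)
      fix S assume S: "S \<in> ?\<Delta>"
      then have "v \<in> Poly_Mapping.keys (m - squarefree_monomial S)"
        using v fin[OF S] by (auto simp: in_keys_iff lookup_minus lookup_squarefree_monomial)
      then show False
        using S False by (auto simp: upper_koszul_def edge_monomials_def)
    qed
    then show ?thesis
      by (simp add: acyclic_at_empty)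
  qed
qed

text \<open>
  For an edge ideal only the squarefree multidegrees contribute, and these are vertex sets.
\<close>

lemma koszul_vanishes_edge_ideal_iff:
  assumes G: "finite_simple_graph V E" and n: "int n = int p + q"
  shows "koszul_vanishes (embed ` edge_ideal V E :: ('v, 'k::field) free_elem set) p q \<longleftrightarrow>
    (\<forall>W. W \<subseteq> V \<longrightarrow> card W = n \<longrightarrow> acyclic_at TYPE('k) (noncovers E W) p)"
proof -
  let ?A = "{(0 :: nat, 0 :: nat)} \<times> edge_monomials V E"
  have "finite {m \<in> edge_monomials V E. int (mdeg m) = q}" for q
    by (rule finite_subset[OF _ finite_monomials[OF finite_V, of "nat q"]]) (auto simp: edge_monomials_def)
  then have "finite (Pair (0 :: nat, 0 :: nat) ` {m \<in> edge_monomials V E. int (mdeg m) = q})" for q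
    by blast
  moreover have "{(e, m) \<in> ?A. int (mdeg m + fst e) = q} =
      Pair (0 :: nat, 0 :: nat) ` {m \<in> edge_monomials V E. int (mdeg m) = q}" for q
    by auto
  ultimately have fin: "finite {(e, m) \<in> ?A. int (mdeg m + fst e) = q}" for q
    by (simp only:)
  have sub: "graded_submodule V (monomial_module ?A :: ('v, 'k) free_elem set)"
    by (rule graded_submodule_monomial_module) (auto simp: edge_monomials_def keys_add_nat)
  have "(\<forall>e m. int (mdeg m + fst e) = int p + q \<longrightarrow> acyclic_at TYPE('k) (upper_koszul ?A e m) p) \<longleftrightarrow>
    (\<forall>W. W \<subseteq> V \<longrightarrow> card W = n \<longrightarrow> acyclic_at TYPE('k) (noncovers E W) p)" (is "?L \<longleftrightarrow> ?R")
  proof (intro iffI allI impI)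
    fix W assume L: ?L and W: "W \<subseteq> V" "card W = n"
    have "mdeg (squarefree_monomial W) = n"
      using W finite_subset[OF W(1) finite_V] by (simp add: mdeg_squarefree_monomial)
    then show "acyclic_at TYPE('k) (noncovers E W) p"
      using L[rule_format, of "squarefree_monomial W" "(0, 0)"] n W by (simp add: upper_koszul_edge_ideal_squarefree)
  next
    fix e :: "nat \<times> nat" and m :: "'v \<Rightarrow>\<^sub>0 nat" assume R: ?R and m: "int (mdeg m + fst e) = int p + q"
    show "acyclic_at TYPE('k) (upper_koszul ?A e m) p"
    proof (cases "\<exists>v. Poly_Mapping.lookup m v \<ge> 2")
      case True
      then show ?thesis
        using acyclic_at_edge_ideal_not_squarefree by blast
    next
      case False
      then have small: "Poly_Mapping.lookup m v < 2" for v
        by (simp add: not_le)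
      have sqfree: "Poly_Mapping.lookup m v = (if v \<in> Poly_Mapping.keys m then 1 else 0)" for v
        using small[of v] by (auto simp: in_keys_iff less_2_cases_iff)
      have m_squarefree: "m = squarefree_monomial (Poly_Mapping.keys m)"
        by (rule poly_mapping_eqI) (simp add: sqfree[symmetric] lookup_squarefree_monomial)
      show ?thesis
      proof (cases "e = (0, 0) \<and> Poly_Mapping.keys m \<subseteq> V")
        case True
        have "card (Poly_Mapping.keys m) = n"
          using m n True arg_cong[OF m_squarefree, of mdeg] by (simp add: mdeg_squarefree_monomial)
        then show ?thesis
          using R True upper_koszul_edge_ideal_squarefree[of "Poly_Mapping.keys m" E] m_squarefree by simp
      next
        case False
        have "upper_koszul ?A e m = {}"
        proof (rule equals0I)
          fix S assume S: "S \<in> upper_koszul ?A e m"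
          then have "e = (0, 0)" "S \<subseteq> V" "S \<subseteq> Poly_Mapping.keys m" "Poly_Mapping.keys (m - squarefree_monomial S) \<subseteq> V"
            by (auto simp: upper_koszul_def edge_monomials_def)
          moreover from this have "Poly_Mapping.keys m = Poly_Mapping.keys (m - squarefree_monomial S) \<union> S"
            using arg_cong[OF diff_squarefree_monomial_add, of S m Poly_Mapping.keys] finite_subset_keys[of S m]
            by (simp add: keys_add_nat keys_squarefree_monomial)
          ultimately show False
            using False by auto
        qed
        then show ?thesis
          by (simp add: acyclic_at_empty)
      qed
    qed
  qed
  then show ?thesis
    unfolding embed_edge_ideal[OF G] by (simp add: koszul_vanishes_monomial_module[OF fin sub])
qed

end

lemma edge_ideal_has_minimal_resolution:
  assumes G: "finite_simple_graph V E"
  shows "\<exists>F. minimal_graded_free_resolution V (edge_ideal V E :: ('v, 'k::field) mpoly set) F"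
proof -
  let ?M = "embed ` edge_ideal V E :: ('v, 'k) free_elem set"
  have "graded_submodule V ?M"
    unfolding embed_edge_ideal[OF G]
    by (rule graded_submodule_monomial_module) (auto simp: edge_monomials_def keys_add_nat)
  moreover have "?M \<subseteq> graded_free V (\<lambda>j. if j = 0 then 1 else 0)"
    unfolding embed_edge_ideal[OF G] graded_free_eq_monomial_module
    by (rule monomial_module_mono) (auto simp: free_monomials_def edge_monomials_def)
  moreover have "finite V"
    using G by (simp add: finite_simple_graph_def)
  ultimately obtain b f where "minimally_resolves V ?M b f"
    using minimally_resolves_exists by blast
  then show ?thesis
    using minimally_resolves_imp_minimal_graded_free_resolution by blast
qed

theorem theorem1p8:
  fixes V :: "'v set" and E :: "'v set set"
    and I :: "('v, 'k::field) mpoly set"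
    and i j :: nat
  assumes "finite_simple_graph V E"
    and "I = edge_ideal V E"
    and "j \<ge> i + 2"
    and "graded_betti V I i j = 0"
    and "graded_betti V I i (j + 1) = 0"
  shows "graded_betti V I (i + 1) (j + 2) = 0"
proof -
  note G = assms(1)
  have finV: "finite V"
    using G by (simp add: finite_simple_graph_def)
  then obtain r :: "'v \<Rightarrow> nat" where "inj_on r V"
    using finite_imp_inj_to_nat_seg by metis
  then interpret ordered_vertices V r
    using finV by unfold_locales
  define F where "F = (SOME F. minimal_graded_free_resolution V I F)"
  have "minimal_graded_free_resolution V I F"
    unfolding F_def assms(2) by (rule someI_ex[OF edge_ideal_has_minimal_resolution[OF G]])
  note res = minimal_graded_free_resolution_imp_minimally_resolves[OF this]
  have betti: "graded_betti V I p n = 0 \<longleftrightarrow>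
      (\<forall>W. W \<subseteq> V \<longrightarrow> card W = n \<longrightarrow> acyclic_at TYPE('k) (noncovers E W) p)" for p n
  proof -
    have "graded_betti V I p n = copies F p n"
      by (simp add: graded_betti_def F_def)
    then show ?thesis
      using koszul_vanishes_iff_no_generators[OF res, of n "int n - int p" p]
        koszul_vanishes_edge_ideal_iff[OF G, of n p "int n - int p", where 'k = 'k]
      by (simp add: assms(2))
  qed
  show ?thesis
    unfolding betti
  proof (intro allI impI)
    fix W assume W: "W \<subseteq> V" "card W = j + 2"
    show "acyclic_at TYPE('k) (noncovers E W) (i + 1)"
    proof (rule acyclic_at_noncovers[OF _ W(1)])
      show "card e = 2" if "e \<in> E" for e
        using G that by (simp add: finite_simple_graph_def)
      show "3 \<le> card W"
        using W(2) assms(3) by simp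
      show "acyclic_at TYPE('k) (noncovers E U) i" if "U \<subseteq> V" "card U + 1 = card W" for U
        using assms(5) that W(2) unfolding betti by simp
      show "acyclic_at TYPE('k) (noncovers E U) i" if "U \<subseteq> V" "card U + 2 = card W" for U
        using assms(4) that W(2) unfolding betti by simp
    qed
  qed
qed

end
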